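(* Let $H_{\rm E}$ be an environment Hamiltonian with discrete spectrum, $\rho_{\rm E}$ a stationary state ($[H_{\rm E},\rho_{\rm E}]=0$), and $\{B_\beta\}$ a family of $N_\beta$ Hermitian environment operators. For each transition frequency $\omega$ let $\gamma(\omega)$ be the positive semidefinite Hermitian matrix with entries $\gamma_{\beta,\beta'}(\omega)=\mathrm{Tr}[B_\beta(\omega)B_{\beta'}^\dagger(\omega)\rho_{\rm E}]$, diagonalised as $\gamma(\omega)=U(\omega)\Lambda(\omega)U^\dagger(\omega)$ with $U(\omega)$ unitary and $\Lambda(\omega)$ diagonal, let $d_\omega=\mathrm{rank}\,\gamma(\omega)$, and put $g_{\beta,l}(\omega)=U_{\beta,l}(\omega)\sqrt{\Lambda_{l,l}(\omega)}$. Let $\widetilde{\mathcal H}_{\rm E}$ be the Hilbert space with orthonormal basis consisting of $|{\rm v}\rangle$ and the vectors $|\omega,l\rangle$, where $\omega$ runs over the transition frequencies and $l$ over the $d_\omega$ indices with $\Lambda_{l,l}(\omega)\ne0$. Set $\sigma_l(\omega)=|{\rm v}\rangle\langle\omega,l|$ and $$\widetilde\rho_{\rm E}=|{\rm v}\rangle\langle{\rm v}|,\qquad\widetilde H_{\rm E}=\sum_{\omega,l}\omega\,\sigma_l^\dagger(\omega)\sigma_l(\omega),\qquad\widetilde B_\beta=\sum_{\omega,l}\big(g_{\beta,l}(\omega)\sigma_l(\omega)+g_{\beta,l}^*(\omega)\sigma_l^\dagger(\omega)\big).$$ Then $\dim\widetilde{\mathcal H}_{\rm E}=1+\sum_\omega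 d_\omega\le1+N_\omega N_\beta$, and all two-time correlation functions are reproduced: for all $\beta,\beta'$ and all real $t,s$, $$\mathrm{Tr}\big[\widetilde B_\beta(t)\widetilde B_{\beta'}(t-s)\widetilde\rho_{\rm E}\big]=\mathrm{Tr}\big[B_\beta(t)B_{\beta'}(t-s)\rho_{\rm E}\big].$$
   Context: $\hbar=1$. $H_{\rm E}=\sum_\varepsilon\varepsilon\,\Pi(\varepsilon)$ with finitely many distinct eigenvalues $\varepsilon$ and spectral projections $\Pi(\varepsilon)$. Transition frequencies $\omega$ are the values $\varepsilon'-\varepsilon$ for eigenvalues $\varepsilon,\varepsilon'$, and $N_\omega$ is their number. The $B_\beta$ are bounded Hermitian operators and $\rho_{\rm E}$ is a density operator. $B_\beta(\omega)=\sum_{\varepsilon'-\varepsilon=\omega}\Pi(\varepsilon)B_\beta\Pi(\varepsilon')$. Interaction picture: $B_\beta(t)=e^{iH_{\rm E}t}B_\beta e^{-iH_{\rm E}t}$ and $\widetilde B_\beta(t)=e^{i\widetilde H_{\rm E}t}\widetilde B_\beta e^{-i\widetilde H_{\rm E}t}$. *)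

theory Defs
  imports "HOL-Analysis.Analysis"
begin

section \<open>Complex Hilbert spaces\<close>

text \<open>
  The topology, norm and completeness are those of the underlying real Hilbert space, whose
  inner product is the real part of the complex one; the complex inner product is linear in its
  second argument.
\<close>

class scaleC =
  fixes scaleC :: "complex \<Rightarrow> 'a \<Rightarrow> 'a" (infixr "*\<^sub>C" 75)

class chilbert_space = scaleC + real_inner + complete_space +
  fixes cinner :: "'a \<Rightarrow> 'a \<Rightarrow> complex"
  assumes scaleC_add_right: "a *\<^sub>C (x + y) = a *\<^sub>C x + a *\<^sub>C y"
    and scaleC_add_left: "(a + b) *\<^sub>C x = a *\<^sub>C x + b *\<^sub>C x"
    and scaleC_scaleC: "a *\<^sub>C b *\<^sub>C x = (a * b) *\<^sub>C x"
    and scaleC_of_real: "complex_of_real r *\<^sub>C x = r *\<^sub>R x"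
    and cinner_commute: "cinner x y = cnj (cinner y x)"
    and cinner_add_right: "cinner x (y + z) = cinner x y + cinner x z"
    and cinner_scaleC_right: "cinner x (a *\<^sub>C y) = a * cinner x y"
    and inner_eq_Re_cinner: "inner x y = Re (cinner x y)"

instantiation complex :: chilbert_space
begin
definition "scaleC a (x :: complex) = a * x"
definition "cinner (x :: complex) y = cnj x * y"
instance
  by standard
    (auto simp: scaleC_complex_def cinner_complex_def algebra_simps scaleR_conv_of_real
      inner_complex_def)
end

instantiation vec :: (chilbert_space, finite) chilbert_space
begin
definition "scaleC a (x :: 'a ^ 'b) = (\<chi> i. a *\<^sub>C x $ i)"
definition "cinner (x :: 'a ^ 'b) y = (\<Sum>i\<in>UNIV. cinner (x $ i) (y $ i))"
instance
proof
  fix x y :: "'a ^ 'b"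
  have "cinner (x $ i) (y $ i) = cnj (cinner (y $ i) (x $ i))" for i
    by (rule cinner_commute)
  then show "cinner x y = cnj (cinner y x)"
    unfolding cinner_vec_def cnj_sum by (intro sum.cong) auto
qed (auto simp: scaleC_vec_def cinner_vec_def vec_eq_iff scaleC_add_right scaleC_add_left
      scaleC_scaleC scaleC_of_real cinner_add_right cinner_scaleC_right
      sum.distrib sum_distrib_left inner_vec_def inner_eq_Re_cinner)
end

global_interpretation cvec: vector_space "scaleC :: complex \<Rightarrow> 'a \<Rightarrow> 'a::chilbert_space"
  defines cspan = cvec.span
    and cdim = cvec.dim
proof
  show "1 *\<^sub>C x = x" for x :: 'a
    using scaleC_of_real[of 1 x] by simp
qed (simp_all add: scaleC_add_right scaleC_add_left scaleC_scaleC)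

definition is_onb_on :: "'i set \<Rightarrow> ('i \<Rightarrow> 'a::chilbert_space) \<Rightarrow> bool" where
  "is_onb_on I f \<longleftrightarrow>
     (\<forall>i\<in>I. \<forall>j\<in>I. cinner (f i) (f j) = (if i = j then 1 else 0)) \<and>
     closure (cspan (f ` I)) = UNIV"

lemma is_onb_on_axis: "is_onb_on UNIV (\<lambda>i. axis i 1 :: complex ^ 'n::finite)"
proof -
  have "cinner (axis i 1 :: complex ^ 'n) (axis j 1) = (if i = j then 1 else 0)" for i j :: 'n
  proof -
    have "cinner (axis i 1 :: complex ^ 'n) (axis j 1) =
          (\<Sum>k\<in>UNIV. if k = i then (if i = j then 1 else 0) else 0)"
      unfolding cinner_vec_def by (intro sum.cong) (auto simp: axis_def cinner_complex_def)
    then show ?thesis by simp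
  qed
  moreover have "x \<in> cspan (range (\<lambda>i. axis i 1 :: complex ^ 'n))" for x :: "complex ^ 'n"
  proof -
    have "x $ j = (\<Sum>i\<in>UNIV. x $ i * axis i 1 $ j)" for j
    proof -
      have "(\<Sum>i\<in>UNIV. x $ i * axis i 1 $ j) = (\<Sum>i\<in>UNIV. if i = j then x $ j else 0)"
        by (intro sum.cong) (auto simp: axis_def)
      then show ?thesis by simp
    qed
    then have "x = (\<Sum>i\<in>UNIV. (x $ i) *\<^sub>C axis i 1)"
      unfolding vec_eq_iff sum_component scaleC_vec_def scaleC_complex_def vec_lambda_beta by blast
    also have "\<dots> \<in> cspan (range (\<lambda>i. axis i 1))"
      by (intro cvec.span_sum cvec.span_scale cvec.span_base) auto
    finally show ?thesis .
  qed
  then have "closure (cspan (range (\<lambda>i. axis i 1 :: complex ^ 'n))) = UNIV"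
    using closure_subset[of "cspan (range (\<lambda>i. axis i 1 :: complex ^ 'n))"] by auto
  ultimately show ?thesis
    by (simp add: is_onb_on_def)
qed


section \<open>Operators\<close>

definition bounded_clinear :: "('a::chilbert_space \<Rightarrow> 'b::chilbert_space) \<Rightarrow> bool" where
  "bounded_clinear A \<longleftrightarrow> bounded_linear A \<and> (\<forall>c x. A (c *\<^sub>C x) = c *\<^sub>C A x)"

definition cadjoint :: "('a::chilbert_space \<Rightarrow> 'b::chilbert_space) \<Rightarrow> 'b \<Rightarrow> 'a" where
  "cadjoint A = (SOME A'. \<forall>x y. cinner (A' x) y = cinner x (A y))"

definition hermitian_op :: "('a::chilbert_space \<Rightarrow> 'a) \<Rightarrow> bool" where
  "hermitian_op A \<longleftrightarrow> bounded_clinear A \<and> (\<forall>x y. cinner (A x) y = cinner x (A y))"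

definition ortho_projection :: "('a::chilbert_space \<Rightarrow> 'a) \<Rightarrow> bool" where
  "ortho_projection P \<longleftrightarrow> hermitian_op P \<and> P \<circ> P = P"

definition ketbra :: "'a::chilbert_space \<Rightarrow> 'b::chilbert_space \<Rightarrow> 'b \<Rightarrow> 'a" where
  "ketbra x y = (\<lambda>z. cinner y z *\<^sub>C x)"

definition op_exp :: "('a::chilbert_space \<Rightarrow> 'a) \<Rightarrow> 'a \<Rightarrow> 'a" where
  "op_exp A = (\<lambda>x. \<Sum>n. (1 / fact n) *\<^sub>R (A ^^ n) x)"

text \<open>
  A bounded operator has convergent diagonal sums, with a common value, in all orthonormal bases
  iff it is of trace class.  Sums over orthonormal bases are unconditional, so the space need
  not be separable.
\<close>

definition has_trace :: "('a::chilbert_space \<Rightarrow> 'a) \<Rightarrow> complex \<Rightarrow> bool" where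
  "has_trace A c \<longleftrightarrow> (\<forall>S. is_onb_on S id \<longrightarrow> ((\<lambda>e. cinner e (A e)) has_sum c) S)"

definition ctrace :: "('a::chilbert_space \<Rightarrow> 'a) \<Rightarrow> complex" where
  "ctrace A = (THE c. has_trace A c)"

text \<open>For a positive operator, \<open>has_trace \<rho> 1\<close> says that it is of trace class with trace one.\<close>

definition density_op :: "('a::chilbert_space \<Rightarrow> 'a) \<Rightarrow> bool" where
  "density_op \<rho> \<longleftrightarrow> hermitian_op \<rho> \<and> (\<forall>x. 0 \<le> Re (cinner x (\<rho> x))) \<and> has_trace \<rho> 1"

definition heisenberg ::
  "('a::chilbert_space \<Rightarrow> 'a) \<Rightarrow> ('a \<Rightarrow> 'a) \<Rightarrow> real \<Rightarrow> 'a \<Rightarrow> 'a" where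
  "heisenberg H A t =
     op_exp (\<lambda>x. (\<i> * of_real t) *\<^sub>C H x) \<circ> A \<circ> op_exp (\<lambda>x. (- \<i> * of_real t) *\<^sub>C H x)"


section \<open>Complex matrices\<close>

definition mat_dagger :: "complex ^ 'n ^ 'm \<Rightarrow> complex ^ 'm ^ 'n" where
  "mat_dagger A = (\<chi> i j. cnj (A $ j $ i))"

definition unitary_mat :: "complex ^ 'n ^ 'n \<Rightarrow> bool" where
  "unitary_mat U \<longleftrightarrow> mat_dagger U ** U = mat 1 \<and> U ** mat_dagger U = mat 1"

definition diagonal_mat :: "complex ^ 'n ^ 'n \<Rightarrow> bool" where
  "diagonal_mat D \<longleftrightarrow> (\<forall>i j. i \<noteq> j \<longrightarrow> D $ i $ j = 0)"

definition psd_mat :: "complex ^ 'n ^ 'n \<Rightarrow> bool" where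
  "psd_mat A \<longleftrightarrow> mat_dagger A = A \<and> (\<forall>x. 0 \<le> Re (cinner x (A *v x)))"


section \<open>The environment\<close>

definition spectral_decomposition ::
  "('h::chilbert_space \<Rightarrow> 'h) \<Rightarrow> real set \<Rightarrow> (real \<Rightarrow> 'h \<Rightarrow> 'h) \<Rightarrow> bool" where
  "spectral_decomposition H E P \<longleftrightarrow>
     finite E \<and>
     (\<forall>\<epsilon>\<in>E. ortho_projection (P \<epsilon>) \<and> P \<epsilon> \<noteq> (\<lambda>x. 0)) \<and>
     (\<forall>\<epsilon>\<in>E. \<forall>\<epsilon>'\<in>E. \<epsilon> \<noteq> \<epsilon>' \<longrightarrow> P \<epsilon> \<circ> P \<epsilon>' = (\<lambda>x. 0)) \<and>
     (\<forall>x. (\<Sum>\<epsilon>\<in>E. P \<epsilon> x) = x) \<and>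
     (\<forall>x. H x = (\<Sum>\<epsilon>\<in>E. \<epsilon> *\<^sub>R P \<epsilon> x))"

definition transition_freqs :: "real set \<Rightarrow> real set" where
  "transition_freqs E = {\<epsilon>' - \<epsilon> |\<epsilon> \<epsilon>'. \<epsilon> \<in> E \<and> \<epsilon>' \<in> E}"

definition freq_component ::
  "real set \<Rightarrow> (real \<Rightarrow> 'h::chilbert_space \<Rightarrow> 'h) \<Rightarrow> ('h \<Rightarrow> 'h) \<Rightarrow> real \<Rightarrow> 'h \<Rightarrow> 'h" where
  "freq_component E P A \<omega> =
     (\<lambda>x. \<Sum>(\<epsilon>, \<epsilon>') \<in> {(\<epsilon>, \<epsilon>'). \<epsilon> \<in> E \<and> \<epsilon>' \<in> E \<and> \<epsilon>' - \<epsilon> = \<omega>}. P \<epsilon> (A (P \<epsilon>' x)))"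

definition corr_mat ::
  "real set \<Rightarrow> (real \<Rightarrow> 'h::chilbert_space \<Rightarrow> 'h) \<Rightarrow> ('b \<Rightarrow> 'h \<Rightarrow> 'h) \<Rightarrow> ('h \<Rightarrow> 'h) \<Rightarrow> real \<Rightarrow>
    complex ^ 'b ^ 'b" where
  "corr_mat E P B \<rho> \<omega> =
     (\<chi> \<beta> \<beta>'. ctrace (freq_component E P (B \<beta>) \<omega> \<circ>
                    cadjoint (freq_component E P (B \<beta>') \<omega>) \<circ> \<rho>))"


section \<open>The auxiliary environment\<close>

text \<open>
  For a unitary diagonalisation of a positive semidefinite matrix, the diagonal entries of
  \<open>\<Lambda>\<close> are nonnegative reals, so \<open>csqrt\<close> is the nonnegative real square root.
\<close>

definition coupling ::
  "(real \<Rightarrow> complex ^ 'b ^ 'b) \<Rightarrow> (real \<Rightarrow> complex ^ 'b ^ 'b) \<Rightarrow> 'b \<Rightarrow> 'b \<Rightarrow> real \<Rightarrow> complex" where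
  "coupling U \<Lambda> \<beta> l \<omega> = U \<omega> $ \<beta> $ l * csqrt (\<Lambda> \<omega> $ l $ l)"

datatype 'b mode_label = Vac | Exc real 'b

definition modes :: "real set \<Rightarrow> (real \<Rightarrow> complex ^ 'b ^ 'b) \<Rightarrow> (real \<times> 'b) set" where
  "modes \<Omega> \<Lambda> = {(\<omega>, l). \<omega> \<in> \<Omega> \<and> \<Lambda> \<omega> $ l $ l \<noteq> 0}"

definition mode_labels :: "(real \<times> 'b) set \<Rightarrow> 'b mode_label set" where
  "mode_labels J = insert Vac {Exc \<omega> l |\<omega> l. (\<omega>, l) \<in> J}"

definition lowering :: "('b mode_label \<Rightarrow> 'k::chilbert_space) \<Rightarrow> 'b \<Rightarrow> real \<Rightarrow> 'k \<Rightarrow> 'k" where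
  "lowering ket l \<omega> = ketbra (ket Vac) (ket (Exc \<omega> l))"

definition aux_state :: "('b mode_label \<Rightarrow> 'k::chilbert_space) \<Rightarrow> 'k \<Rightarrow> 'k" where
  "aux_state ket = ketbra (ket Vac) (ket Vac)"

definition aux_hamiltonian ::
  "('b mode_label \<Rightarrow> 'k::chilbert_space) \<Rightarrow> (real \<times> 'b) set \<Rightarrow> 'k \<Rightarrow> 'k" where
  "aux_hamiltonian ket J =
     (\<lambda>x. \<Sum>(\<omega>, l)\<in>J. \<omega> *\<^sub>R (cadjoint (lowering ket l \<omega>) \<circ> lowering ket l \<omega>) x)"

definition aux_coupling_op ::
  "('b mode_label \<Rightarrow> 'k::chilbert_space) \<Rightarrow> (real \<times> 'b) set \<Rightarrow>
    ('b \<Rightarrow> 'b \<Rightarrow> real \<Rightarrow> complex) \<Rightarrow> 'b \<Rightarrow> 'k \<Rightarrow> 'k" where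
  "aux_coupling_op ket J g \<beta> =
     (\<lambda>x. \<Sum>(\<omega>, l)\<in>J. g \<beta> l \<omega> *\<^sub>C lowering ket l \<omega> x +
                       cnj (g \<beta> l \<omega>) *\<^sub>C cadjoint (lowering ket l \<omega>) x)"

end

theory Submission
  imports Defs
begin

text \<open>
  A density operator splits as \<open>\<rho> = \<Sum>\<^sub>n |v\<^sub>n\<rangle>\<langle>v\<^sub>n|\<close> (a countable Cholesky decomposition, which
  needs neither square roots nor the spectral theorem), so for bounded \<open>A\<close> Parseval's identity and
  Fubini give \<open>Tr[A \<rho>] = \<Sum>\<^sub>n \<langle>v\<^sub>n, A v\<^sub>n\<rangle>\<close> in every orthonormal basis.  Hence \<open>\<gamma>(\<omega>)\<close> is a Gram matrix.
  By stationarity \<open>Tr[B\<^sub>\<beta>(\<omega>) B\<^sub>\<beta>\<^sub>'(\<omega>')\<^sup>\<dagger> \<rho>]\<close> vanishes for \<open>\<omega> \<noteq> \<omega>'\<close>, and both correlation functions are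
  equal to \<open>\<Sum>\<^sub>\<omega> e\<^sup>-\<^sup>i\<^sup>\<omega>\<^sup>s \<gamma>\<^sub>\<beta>\<^sub>\<beta>\<^sub>'(\<omega>)\<close>: on the auxiliary side only the path from the vacuum to \<open>|\<omega>, l\<rangle>\<close>
  and back contributes.
\<close>

section \<open>Complex inner products\<close>

text \<open>Two choice operators in the definitions shape the argument. \<open>ctrace\<close> is a
  definite description over all orthonormal bases, on a space that may be non-separable: a basis
  must be shown to exist at all, and each trace must be given a value that does not mention a basis.
  The sum over the vectors v_n supplies this value. \<open>cadjoint\<close> is an arbitrary choice,
  so operators are carried together with an explicit adjoint; for the frequency components it is at
  hand because negating the frequency exchanges the two projections. The dependence on t cancels on
  the original side because stationarity forces equal frequencies in the two factors, and on the
  auxiliary side because the vacuum has energy zero.\<close>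

lemma cinner_add_left: "cinner (x + y) z = cinner x z + cinner y z"
  by (metis cinner_add_right cinner_commute complex_cnj_add)

lemma cinner_scaleC_left: "cinner (a *\<^sub>C x) y = cnj a * cinner x y"
  by (metis cinner_scaleC_right cinner_commute complex_cnj_mult)

lemma cinner_zero_right [simp]: "cinner x 0 = 0"
  by (metis add_cancel_left_right cinner_add_right)

lemma cinner_zero_left [simp]: "cinner 0 x = 0"
  by (metis cinner_commute cinner_zero_right complex_cnj_zero)

lemma cinner_minus_right: "cinner x (- y) = - cinner x y"
  by (metis cinner_add_right cinner_zero_right add.right_inverse minus_unique)

lemma cinner_minus_left: "cinner (- x) y = - cinner x y"
  by (metis cinner_minus_right cinner_commute complex_cnj_minus)

lemma cinner_diff_right: "cinner x (y - z) = cinner x y - cinner x z"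
  by (metis cinner_add_right cinner_minus_right diff_conv_add_uminus)

lemma cinner_diff_left: "cinner (x - y) z = cinner x z - cinner y z"
  by (metis cinner_add_left cinner_minus_left diff_conv_add_uminus)

lemma cinner_sum_right: "cinner x (\<Sum>i\<in>I. f i) = (\<Sum>i\<in>I. cinner x (f i))"
  by (induction I rule: infinite_finite_induct) (auto simp: cinner_add_right)

lemma cinner_sum_left: "cinner (\<Sum>i\<in>I. f i) x = (\<Sum>i\<in>I. cinner (f i) x)"
  by (induction I rule: infinite_finite_induct) (auto simp: cinner_add_left)

lemma scaleC_one [simp]: "1 *\<^sub>C x = (x :: 'a::chilbert_space)"
  using scaleC_of_real[of 1 x] by simp

lemma cinner_scaleR_right: "cinner x (r *\<^sub>R y) = of_real r * cinner x y"
  by (metis cinner_scaleC_right scaleC_of_real)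

lemma cinner_scaleR_left: "cinner (r *\<^sub>R x) y = of_real r * cinner x y"
  by (metis cinner_scaleC_left scaleC_of_real complex_cnj_complex_of_real)

lemmas cinner_simps =
  cinner_add_left cinner_add_right cinner_diff_left cinner_diff_right
  cinner_minus_left cinner_minus_right cinner_scaleC_left cinner_scaleC_right
  cinner_scaleR_left cinner_scaleR_right

lemma cinner_self: "cinner x x = complex_of_real ((norm x)\<^sup>2)"
proof (rule complex_eqI)
  show "Re (cinner x x) = Re (complex_of_real ((norm x)\<^sup>2))"
    by (simp add: inner_eq_Re_cinner[symmetric] power2_norm_eq_inner)
  show "Im (cinner x x) = Im (complex_of_real ((norm x)\<^sup>2))"
    using cinner_commute[of x x] by (simp add: complex_eq_iff)
qed

lemma cinner_self_eq_0_iff [simp]: "cinner x x = 0 \<longleftrightarrow> x = 0"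
  by (simp add: cinner_self)

lemma cinner_ext: "(\<And>x. cinner x y = cinner x z) \<Longrightarrow> y = z"
  by (metis cinner_diff_right cinner_self_eq_0_iff right_minus_eq)

lemma norm_scaleC: "norm (a *\<^sub>C x) = cmod a * norm x" for x :: "'a::chilbert_space"
proof -
  have "complex_of_real ((norm (a *\<^sub>C x))\<^sup>2) = cnj a * (a * of_real ((norm x)\<^sup>2))"
    by (simp only: cinner_self[symmetric] cinner_scaleC_left cinner_scaleC_right mult.left_commute)
  also have "\<dots> = complex_of_real ((cmod a * norm x)\<^sup>2)"
    by (simp add: power_mult_distrib complex_norm_square[symmetric] algebra_simps)
  finally show ?thesis
    by (metis of_real_eq_iff norm_ge_zero mult_nonneg_nonneg power2_eq_iff_nonneg)
qed

lemma cmod_cinner_commute: "cmod (cinner x y) = cmod (cinner y x)"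
  by (metis cinner_commute complex_mod_cnj)

lemma cinner_mult_cinner_commute:
  "cinner x y * cinner y x = complex_of_real ((cmod (cinner x y))\<^sup>2)"
  by (metis cinner_commute complex_norm_square)


section \<open>Positive operators\<close>

definition clinear :: "('a::chilbert_space \<Rightarrow> 'b::chilbert_space) \<Rightarrow> bool" where
  "clinear T \<longleftrightarrow> (\<forall>x y. T (x + y) = T x + T y) \<and> (\<forall>c x. T (c *\<^sub>C x) = c *\<^sub>C T x)"

lemma clinear_add: "clinear T \<Longrightarrow> T (x + y) = T x + T y"
  and clinear_scaleC: "clinear T \<Longrightarrow> T (c *\<^sub>C x) = c *\<^sub>C T x"
  by (auto simp: clinear_def)

lemma clinear_zero: "clinear T \<Longrightarrow> T 0 = 0"
  by (metis clinear_add add_cancel_left_right)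

lemma clinear_minus: "clinear T \<Longrightarrow> T (- x) = - T x"
  using clinear_scaleC[of T "-1" x] by simp

lemma clinear_diff: "clinear T \<Longrightarrow> T (x - y) = T x - T y"
  using clinear_add[of T x "- y"] by (simp add: clinear_minus)

lemma clinear_sum: "clinear T \<Longrightarrow> T (\<Sum>i\<in>I. f i) = (\<Sum>i\<in>I. T (f i))"
  by (induction I rule: infinite_finite_induct) (auto simp: clinear_add clinear_zero)

lemma bounded_clinear_imp_clinear: "bounded_clinear T \<Longrightarrow> clinear T"
  by (auto simp: bounded_clinear_def clinear_def linear_simps)

text \<open>Unlike \<open>hermitian_op\<close>, this asks for no continuity, so a deflated operator
  can be checked by algebra alone.\<close>

definition psd_op :: "('a::chilbert_space \<Rightarrow> 'a) \<Rightarrow> bool" where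
  "psd_op T \<longleftrightarrow> clinear T \<and> (\<forall>x y. cinner (T x) y = cinner x (T y)) \<and>
     (\<forall>x. 0 \<le> Re (cinner x (T x)))"

lemma psd_op_id: "psd_op (\<lambda>x. x)"
  by (simp add: psd_op_def clinear_def cinner_self)

lemma psd_op_quadratic:
  assumes "psd_op T"
  shows "cinner x (T x) = of_real (Re (cinner x (T x)))"
proof -
  have "cnj (cinner x (T x)) = cinner x (T x)"
    using assms by (metis psd_op_def cinner_commute)
  then show ?thesis
    by (simp add: complex_eq_iff)
qed

text \<open>Positivity is applied to \<open>x - r z y\<close> for real \<open>r\<close>; the
  resulting quadratic in \<open>r\<close> also handles forms that vanish on nonzero vectors.\<close>

lemma psd_op_Cauchy_Schwarz:
  assumes T: "psd_op T"
  shows "(cmod (cinner x (T y)))\<^sup>2 \<le> Re (cinner x (T x)) * Re (cinner y (T y))"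
proof -
  have lin: "clinear T" and sym: "\<And>x y. cinner (T x) y = cinner x (T y)"
    and pos: "\<And>x. 0 \<le> Re (cinner x (T x))"
    using T by (auto simp: psd_op_def)
  define z where "z = cinner y (T x)"
  have z': "cinner x (T y) = cnj z"
    unfolding z_def by (metis sym cinner_commute)
  \<comment> \<open>The factor \<open>z\<close> aligns the phase of \<open>y\<close>, so both cross
    terms are real and \<open>r\<close> can stay real.\<close>
  have expand: "Re (cinner (x - (of_real r * z) *\<^sub>C y) (T (x - (of_real r * z) *\<^sub>C y))) =
      Re (cinner x (T x)) - 2 * r * (cmod z)\<^sup>2 + r\<^sup>2 * (cmod z)\<^sup>2 * Re (cinner y (T y))" for r :: real
  proof -
    define q where "q = Re (cinner y (T y))"
    have "cinner (x - (of_real r * z) *\<^sub>C y) (T (x - (of_real r * z) *\<^sub>C y)) =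
      cinner x (T x) - of_real (2 * r) * (z * cnj z) + of_real (r\<^sup>2) * (z * cnj z) * cinner y (T y)"
      by (simp add: clinear_diff[OF lin] clinear_scaleC[OF lin] cinner_simps z'
          z_def[symmetric] algebra_simps power2_eq_square)
    also have "\<dots> = cinner x (T x) - of_real (2 * r * (cmod z)\<^sup>2) + of_real (r\<^sup>2 * (cmod z)\<^sup>2 * q)"
      unfolding q_def complex_norm_square[symmetric]
      by (subst psd_op_quadratic[OF T, of y]) simp
    finally show ?thesis
      by (simp add: q_def)
  qed
  define q where "q = Re (cinner y (T y))"
  have le: "2 * r * (cmod z)\<^sup>2 \<le> Re (cinner x (T x)) + r\<^sup>2 * (cmod z)\<^sup>2 * q" for r
    using expand[of r] pos[of "x - (of_real r * z) *\<^sub>C y"] unfolding q_def by linarith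
  have "(cmod z)\<^sup>2 \<le> Re (cinner x (T x)) * q"
  proof (cases "q = 0")
    case True
    have "(cmod z)\<^sup>2 = 0"
    proof (rule ccontr)
      assume "(cmod z)\<^sup>2 \<noteq> 0"
      \<comment> \<open>With \<open>q = 0\<close> the bound is linear in \<open>r\<close>; this
        \<open>r\<close> would give \<open>a + 1 <= a\<close> for
        \<open>a = Re (cinner x (T x))\<close>.\<close>
      then show False
        using le[of "(Re (cinner x (T x)) + 1) / (2 * (cmod z)\<^sup>2)"] True
        by simp
    qed
    then show ?thesis using True by simp
  next
    case False
    then have "q > 0" using pos[of y] q_def by linarith
    \<comment> \<open>\<open>1 / q\<close> minimises the quadratic.\<close>
    then show ?thesis
      using le[of "1 / q"] by (simp add: field_simps power2_eq_square)
  qed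
  then show ?thesis
    by (simp add: z' q_def)
qed

lemma cmod_cinner_le: "cmod (cinner x y) \<le> norm x * norm y"
proof -
  have "(cmod (cinner x y))\<^sup>2 \<le> (norm x * norm y)\<^sup>2"
    using psd_op_Cauchy_Schwarz[OF psd_op_id, of x y]
    by (simp add: cinner_self power_mult_distrib del: of_real_power)
  then show ?thesis
    by (rule power2_le_imp_le) simp
qed

text \<open>Cauchy-Schwarz against the vector \<open>T y\<close> bounds the fourth power of
  \<open>norm (T y)\<close> by zero.\<close>

lemma psd_op_kernel: "psd_op T \<Longrightarrow> Re (cinner y (T y)) = 0 \<Longrightarrow> T y = 0"
  using psd_op_Cauchy_Schwarz[of T "T y" y] by (simp add: cinner_self)

lemma bounded_linear_cinner_right: "bounded_linear (cinner x)"
  by (rule bounded_linear_intro[where K = "norm x"])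
    (auto simp: cinner_simps scaleR_conv_of_real cmod_cinner_le mult.commute[of _ "norm x"])

lemma bounded_linear_scaleC_left: "bounded_linear (\<lambda>a. a *\<^sub>C (x :: 'a::chilbert_space))"
proof (rule bounded_linear_intro[where K = "norm x"])
  show "(r *\<^sub>R a) *\<^sub>C x = r *\<^sub>R a *\<^sub>C x" for r a
    by (simp only: scaleR_conv_of_real scaleC_scaleC[symmetric] scaleC_of_real)
qed (auto simp: scaleC_add_left norm_scaleC)

lemma bounded_linear_scaleC_right: "bounded_linear (\<lambda>x. a *\<^sub>C (x :: 'a::chilbert_space))"
proof (rule bounded_linear_intro[where K = "cmod a"])
  show "a *\<^sub>C r *\<^sub>R x = r *\<^sub>R a *\<^sub>C x" for r and x :: 'a
    by (simp only: scaleC_of_real[symmetric] scaleC_scaleC mult.commute)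
qed (auto simp: scaleC_add_right norm_scaleC mult.commute)

text \<open>Over the complex numbers the quadratic form determines the sesquilinear form. This is
  used with the identity, for Parseval, and with \<rho>, for its rank-one expansion.\<close>

lemma has_sum_polarization:
  fixes T :: "'a::chilbert_space \<Rightarrow> 'a"
  assumes T: "psd_op T"
    and sum: "\<And>x. ((\<lambda>i. (cmod (cinner (v i) x))\<^sup>2) has_sum Re (cinner x (T x))) I"
  shows "((\<lambda>i. cinner x (v i) * cinner (v i) y) has_sum cinner x (T y)) I"
proof -
  have lin: "clinear T" using T by (simp add: psd_op_def)
  have sum': "((\<lambda>i. cinner z (v i) * cinner (v i) z) has_sum cinner z (T z)) I" for z
  proof -
    have "((\<lambda>i. complex_of_real ((cmod (cinner (v i) z))\<^sup>2)) has_sum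
        complex_of_real (Re (cinner z (T z)))) I"
      using sum[of z] has_sum_of_real by blast
    then show ?thesis
      by (simp only: psd_op_quadratic[OF T, symmetric] cinner_mult_cinner_commute[symmetric])
        (simp only: mult.commute)
  qed
  \<comment> \<open>The weights \<open>1, -1, -\<i>, \<i>\<close> at
    \<open>c = 1, -1, \<i>, -\<i>\<close> cancel the diagonal terms and the term in
    \<open>cinner y x\<close>, and leave four times the term in \<open>cinner x y\<close>.\<close>
  let ?q = "\<lambda>c i. cinner (x + c *\<^sub>C y) (v i) * cinner (v i) (x + c *\<^sub>C y)"
  have "((\<lambda>i. (1/4) * (?q 1 i + - (?q (-1) i) + (- \<i>) * ?q \<i> i + \<i> * ?q (- \<i>) i)) has_sum
      (1/4) * (cinner (x + 1 *\<^sub>C y) (T (x + 1 *\<^sub>C y)) + - cinner (x + (-1) *\<^sub>C y) (T (x + (-1) *\<^sub>C y))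
        + (- \<i>) * cinner (x + \<i> *\<^sub>C y) (T (x + \<i> *\<^sub>C y))
        + \<i> * cinner (x + (- \<i>) *\<^sub>C y) (T (x + (- \<i>) *\<^sub>C y)))) I"
    by (intro has_sum_cmult_right has_sum_add sum') (simp only: has_sum_uminus minus_minus sum')
  moreover have "(1/4) * (?q 1 i + - (?q (-1) i) + (- \<i>) * ?q \<i> i + \<i> * ?q (- \<i>) i) =
      cinner x (v i) * cinner (v i) y" for i
    by (simp add: cinner_simps algebra_simps)
  moreover have "(1/4) * (cinner (x + 1 *\<^sub>C y) (T (x + 1 *\<^sub>C y)) + - cinner (x + (-1) *\<^sub>C y) (T (x + (-1) *\<^sub>C y))
        + (- \<i>) * cinner (x + \<i> *\<^sub>C y) (T (x + \<i> *\<^sub>C y))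
        + \<i> * cinner (x + (- \<i>) *\<^sub>C y) (T (x + (- \<i>) *\<^sub>C y))) = cinner x (T y)"
    by (simp add: clinear_add[OF lin] clinear_scaleC[OF lin] cinner_simps algebra_simps del: cvec.scale_minus_left)
  ultimately show ?thesis by simp
qed


section \<open>Orthonormal bases\<close>

definition orthonormal :: "'a::chilbert_space set \<Rightarrow> bool" where
  "orthonormal S \<longleftrightarrow> (\<forall>e\<in>S. \<forall>f\<in>S. cinner e f = (if e = f then 1 else 0))"

lemma is_onb_on_id: "is_onb_on S id \<longleftrightarrow> orthonormal S \<and> closure (cspan S) = UNIV"
  by (auto simp: is_onb_on_def orthonormal_def)

lemma orthonormal_subset: "orthonormal S \<Longrightarrow> F \<subseteq> S \<Longrightarrow> orthonormal F"
  unfolding orthonormal_def by blast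

lemma cinner_orthonormal_sum:
  assumes "orthonormal F" "finite F" "e \<in> F"
  shows "cinner e (\<Sum>f\<in>F. c f *\<^sub>C f) = c e"
proof -
  have "cinner e (\<Sum>f\<in>F. c f *\<^sub>C f) = (\<Sum>f\<in>F. if f = e then c e else 0)"
    unfolding cinner_sum_right using assms
    by (intro sum.cong) (auto simp: orthonormal_def cinner_scaleC_right)
  then show ?thesis using assms by simp
qed

section \<open>Bessel's inequality and Parseval's identity\<close>

text \<open>The Pythagorean identity behind Bessel's inequality and best approximation.\<close>

lemma norm_diff_orthonormal_sum:
  assumes F: "orthonormal F" "finite F"
  shows "(norm (x - (\<Sum>e\<in>F. c e *\<^sub>C e)))\<^sup>2 =
    (norm x)\<^sup>2 - (\<Sum>e\<in>F. (cmod (cinner e x))\<^sup>2) + (\<Sum>e\<in>F. (cmod (c e - cinner e x))\<^sup>2)"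
proof -
  let ?s = "\<Sum>e\<in>F. c e *\<^sub>C e"
  have ss: "cinner ?s ?s = (\<Sum>e\<in>F. cnj (c e) * c e)"
    by (simp add: cinner_sum_left[of _ _ ?s] cinner_scaleC_left cinner_orthonormal_sum[OF F])
  have xs: "cinner x ?s = (\<Sum>e\<in>F. c e * cnj (cinner e x))"
    by (simp add: cinner_sum_right cinner_scaleC_right cinner_commute[of x])
  have sx: "cinner ?s x = (\<Sum>e\<in>F. cnj (c e) * cinner e x)"
    by (simp add: cinner_sum_left cinner_scaleC_left)
  have "complex_of_real ((norm (x - ?s))\<^sup>2) =
      of_real ((norm x)\<^sup>2) + (\<Sum>e\<in>F. cnj (c e) * c e - c e * cnj (cinner e x) - cnj (c e) * cinner e x)"
    unfolding cinner_self[symmetric] cinner_diff_left cinner_diff_right ss xs sx sum_subtractf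
    by simp
  also have "\<dots> = of_real ((norm x)\<^sup>2) +
      (\<Sum>e\<in>F. of_real ((cmod (c e - cinner e x))\<^sup>2) - of_real ((cmod (cinner e x))\<^sup>2))"
    unfolding complex_norm_square
    by (intro arg_cong2[where f = "(+)"] refl sum.cong) (simp_all add: algebra_simps)
  also have "\<dots> = complex_of_real ((norm x)\<^sup>2 - (\<Sum>e\<in>F. (cmod (cinner e x))\<^sup>2) +
      (\<Sum>e\<in>F. (cmod (c e - cinner e x))\<^sup>2))"
    unfolding sum_subtractf by simp
  finally show ?thesis
    by (simp only: of_real_eq_iff)
qed

lemma Bessel_inequality:
  assumes "orthonormal F" "finite F"
  shows "(\<Sum>e\<in>F. (cmod (cinner e x))\<^sup>2) \<le> (norm x)\<^sup>2"
  using norm_diff_orthonormal_sum[OF assms, of x "\<lambda>e. cinner e x"]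
    zero_le_power2[of "norm (x - (\<Sum>e\<in>F. cinner e x *\<^sub>C e))"]
  by (simp del: zero_le_power2)

text \<open>Approximating \<open>x\<close> by a finite combination over \<open>F\<close> bounds the
  Bessel defect on every finite superset of \<open>F\<close>, because the Fourier coefficients give
  the best approximation.\<close>

lemma Parseval_identity:
  assumes S: "orthonormal S" and x: "x \<in> closure (cspan S)"
  shows "((\<lambda>e. (cmod (cinner e x))\<^sup>2) has_sum (norm x)\<^sup>2) S"
  unfolding has_sum_def tendsto_iff eventually_finite_subsets_at_top
proof (intro allI impI)
  fix \<epsilon> :: real assume "\<epsilon> > 0"
  then obtain y where y: "y \<in> cspan S" "dist y x < sqrt \<epsilon>"
    using x unfolding closure_approachable by (meson real_sqrt_gt_zero)
  obtain F c where F: "finite F" "F \<subseteq> S" "y = (\<Sum>e\<in>F. c e *\<^sub>C e)"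
    using y(1) unfolding cvec.span_explicit by blast
  have "dist (\<Sum>e\<in>G. (cmod (cinner e x))\<^sup>2) ((norm x)\<^sup>2) < \<epsilon>"
    if G: "finite G" "F \<subseteq> G" "G \<subseteq> S" for G
  proof -
    \<comment> \<open>Extending by zero turns \<open>y\<close> into a combination over the larger
      set \<open>G\<close>.\<close>
    define c' where "c' e = (if e \<in> F then c e else 0)" for e
    have "y = (\<Sum>e\<in>G. c' e *\<^sub>C e)"
      unfolding F(3) using G by (intro sum.mono_neutral_cong_left) (auto simp: c'_def)
    then have "(norm x)\<^sup>2 - (\<Sum>e\<in>G. (cmod (cinner e x))\<^sup>2) \<le> (norm (x - y))\<^sup>2"
      using norm_diff_orthonormal_sum[OF orthonormal_subset[OF S G(3)] G(1), of x c']
      by (simp add: sum_nonneg)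
    also have "\<dots> < \<epsilon>"
      using y(2) \<open>\<epsilon> > 0\<close> by (metis dist_commute dist_norm norm_ge_zero real_sqrt_less_iff real_sqrt_unique)
    finally show ?thesis
      using Bessel_inequality[OF orthonormal_subset[OF S G(3)] G(1), of x]
      by (simp add: dist_real_def)
  qed
  then show "\<exists>X. finite X \<and> X \<subseteq> S \<and> (\<forall>Y. finite Y \<and> X \<subseteq> Y \<and> Y \<subseteq> S \<longrightarrow>
      dist (\<Sum>e\<in>Y. (cmod (cinner e x))\<^sup>2) ((norm x)\<^sup>2) < \<epsilon>)"
    using F by blast
qed

lemma onb_has_sum_norm:
  "is_onb_on S id \<Longrightarrow> ((\<lambda>e. (cmod (cinner e x))\<^sup>2) has_sum (norm x)\<^sup>2) S"
  by (simp add: is_onb_on_id Parseval_identity)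

lemma onb_has_sum_cinner:
  "is_onb_on S id \<Longrightarrow> ((\<lambda>e. cinner x e * cinner e y) has_sum cinner x y) S"
  by (rule has_sum_polarization[OF psd_op_id]) (simp add: onb_has_sum_norm cinner_self)

text \<open>The Fourier series of \<open>x\<close> converges by completeness, also for uncountable
  \<open>S\<close>, and its sum lies in the closed span; the remainder is therefore nonzero, and it
  is orthogonal to \<open>S\<close>.\<close>

lemma orthogonal_complement_nontrivial:
  fixes S :: "'a::chilbert_space set"
  assumes S: "orthonormal S" and x: "x \<notin> closure (cspan S)"
  shows "\<exists>y. y \<noteq> 0 \<and> (\<forall>e\<in>S. cinner e y = 0)"
proof -
  let ?f = "\<lambda>e. cinner e x *\<^sub>C e"
  let ?\<phi> = "\<lambda>e. (cmod (cinner e x))\<^sup>2"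
  have "?\<phi> summable_on S"
    by (rule nonneg_bounded_partial_sums_imp_summable_on[where C = "(norm x)\<^sup>2"])
      (auto intro!: eventually_finite_subsets_at_top_weakI Bessel_inequality intro: orthonormal_subset[OF S])
  then have cau: "cauchy_filter (filtermap (sum ?\<phi>) (finite_subsets_at_top S))"
    unfolding summable_on_def has_sum_def by (auto intro: nhds_imp_cauchy_filter simp: filterlim_def)
  have norm_sum: "(norm (sum ?f G))\<^sup>2 = sum ?\<phi> G" if "finite G" "G \<subseteq> S" for G
  proof -
    have "cinner (sum ?f G) (sum ?f G) = (\<Sum>e\<in>G. complex_of_real (?\<phi> e))"
      unfolding cinner_sum_left[of _ _ "sum ?f G"]
      by (intro sum.cong)
        (auto simp: cinner_scaleC_left complex_norm_square[symmetric] mult.commute[of "cnj _"]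
          cinner_orthonormal_sum[OF orthonormal_subset[OF S that(2)] that(1)])
    then show ?thesis
      by (simp only: cinner_self of_real_sum[symmetric] of_real_eq_iff)
  qed
  \<comment> \<open>For nested index sets, the squared norm of a difference of vector sums is the
    difference of the scalar sums, so the scalar Cauchy property transfers.\<close>
  have "cauchy_filter (filtermap (sum ?f) (finite_subsets_at_top S))"
    unfolding cauchy_filter_metric_filtermap
  proof (intro allI impI)
    fix \<epsilon> :: real assume "\<epsilon> > 0"
    then have "(\<epsilon> / 2)\<^sup>2 > 0" by simp
    from cau[unfolded cauchy_filter_metric_filtermap, rule_format, OF this]
    obtain Q where Q: "eventually Q (finite_subsets_at_top S) \<and>
        (\<forall>F G. Q F \<and> Q G \<longrightarrow> dist (sum ?\<phi> F) (sum ?\<phi> G) < (\<epsilon> / 2)\<^sup>2)" ..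
    note Qd = Q[THEN conjunct2, rule_format, OF conjI]
    have "\<exists>X. finite X \<and> X \<subseteq> S \<and> (\<forall>Y. finite Y \<and> X \<subseteq> Y \<and> Y \<subseteq> S \<longrightarrow> Q Y)"
      by (rule Q[THEN conjunct1, unfolded eventually_finite_subsets_at_top])
    then obtain X where X: "finite X" "X \<subseteq> S"
      and XQ: "\<And>Y. finite Y \<Longrightarrow> X \<subseteq> Y \<Longrightarrow> Y \<subseteq> S \<Longrightarrow> Q Y"
      by auto
    define R where "R Y \<longleftrightarrow> finite Y \<and> X \<subseteq> Y \<and> Y \<subseteq> S" for Y
    have "eventually R (finite_subsets_at_top S)"
      unfolding eventually_finite_subsets_at_top R_def using X by blast
    \<comment> \<open>Two finite sets need not be nested, so each is compared with \<open>X\<close>,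
      at the cost of half of \<epsilon>.\<close>
    moreover have near: "norm (sum ?f Y - sum ?f X) < \<epsilon> / 2" if "R Y" for Y
    proof -
      have Y: "finite Y" "X \<subseteq> Y" "Y \<subseteq> S" using that by (auto simp: R_def)
      have "(norm (sum ?f Y - sum ?f X))\<^sup>2 = sum ?\<phi> (Y - X)"
        using norm_sum[of "Y - X"] Y by (auto simp: sum_diff)
      also have "\<dots> = sum ?\<phi> Y - sum ?\<phi> X" using Y by (simp add: sum_diff)
      also have "\<dots> < (\<epsilon> / 2)\<^sup>2"
        using Qd[OF XQ[OF Y] XQ[OF X(1) subset_refl X(2)]]
        unfolding dist_real_def by linarith
      finally show ?thesis
        by (rule power2_less_imp_less) (use \<open>\<epsilon> > 0\<close> in simp)
    qed
    moreover have "dist (sum ?f Y) (sum ?f Z) < \<epsilon>" if "R Y" "R Z" for Y Z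
      using near[OF that(1)] near[OF that(2)] norm_triangle_ineq4[of "sum ?f Y - sum ?f X" "sum ?f Z - sum ?f X"]
      by (simp add: dist_norm)
    ultimately show "\<exists>P. eventually P (finite_subsets_at_top S) \<and>
        (\<forall>F G. P F \<and> P G \<longrightarrow> dist (sum ?f F) (sum ?f G) < \<epsilon>)"
      by blast
  qed
  moreover have "complete (UNIV :: 'a set)"
    by (meson Cauchy_convergent UNIV_I complete_def convergent_def)
  ultimately obtain p where "(sum ?f \<longlongrightarrow> p) (finite_subsets_at_top S)"
    using cauchy_filter_complete_converges[of "filtermap (sum ?f) (finite_subsets_at_top S)" UNIV]
    by (auto simp: filterlim_def filtermap_bot_iff)
  then have p: "(?f has_sum p) S"
    by (simp add: has_sum_def)
  have "p \<in> closure (cspan S)"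
    using p unfolding has_sum_def
    by (rule Lim_in_closed_set[OF closed_closure, rotated 2])
      (auto intro!: eventually_finite_subsets_at_top_weakI closure_subset[THEN subsetD]
        cvec.span_sum cvec.span_scale intro: cvec.span_base)
  then have "x - p \<noteq> 0" using x by auto
  moreover have "cinner e (x - p) = 0" if "e \<in> S" for e
  proof -
    have "((\<lambda>f. cinner e (?f f)) has_sum cinner e p) S"
      using has_sum_bounded_linear[OF bounded_linear_cinner_right p] by (simp add: o_def)
    \<comment> \<open>Against \<open>e\<close> only the summand with index \<open>e\<close>
      survives.\<close>
    moreover have "((\<lambda>f. cinner e (?f f)) has_sum cinner e x) S \<longleftrightarrow>
        ((\<lambda>f. cinner e (?f f)) has_sum cinner e x) {e}"
      using S that by (intro has_sum_cong_neutral) (auto simp: orthonormal_def cinner_scaleC_right)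
    moreover have "cinner e (?f e) = cinner e x"
      using S that by (simp add: orthonormal_def cinner_scaleC_right)
    ultimately show ?thesis
      using has_sum_unique by (fastforce simp: cinner_diff_right has_sum_finite_iff)
  qed
  ultimately show ?thesis by blast
qed

text \<open>Without a basis, \<open>has_trace\<close> would hold vacuously for every value and
  \<open>ctrace\<close> would be undetermined. A maximal orthonormal set has dense span, since
  otherwise a unit vector orthogonal to it could be added.\<close>

lemma onb_exists: "\<exists>S :: 'a::chilbert_space set. is_onb_on S id"
proof -
  have "\<exists>M\<in>Collect orthonormal. \<forall>X\<in>Collect orthonormal. M \<subseteq> X \<longrightarrow> X = (M :: 'a set)"
  proof (rule subset_Zorn')
    fix C assume C: "subset.chain (Collect orthonormal) (C :: 'a set set)"
    have "cinner e f = (if e = f then 1 else 0)" if "e \<in> \<Union>C" "f \<in> \<Union>C" for e f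
    proof -
      obtain A B where "A \<in> C" "B \<in> C" "e \<in> A" "f \<in> B" using \<open>e \<in> \<Union>C\<close> \<open>f \<in> \<Union>C\<close> by blast
      moreover have "A \<subseteq> B \<or> B \<subseteq> A"
        using C \<open>A \<in> C\<close> \<open>B \<in> C\<close> by (meson subset_chain_def)
      ultimately obtain D where "D \<in> C" "e \<in> D" "f \<in> D" by blast
      then show ?thesis
        using C by (auto simp: subset_chain_def orthonormal_def)
    qed
    then show "\<Union>C \<in> Collect orthonormal" by (simp add: orthonormal_def)
  qed
  then obtain M :: "'a set" where M: "orthonormal M"
    and max: "\<And>X. orthonormal X \<Longrightarrow> M \<subseteq> X \<Longrightarrow> X = M" by auto
  have "x \<in> closure (cspan M)" for x
  proof (rule ccontr)
    assume "x \<notin> closure (cspan M)"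
    then obtain y where y: "y \<noteq> 0" and orth: "\<And>e. e \<in> M \<Longrightarrow> cinner e y = 0"
      using orthogonal_complement_nontrivial[OF M] by blast
    define z where "z = (1 / norm y) *\<^sub>R y"
    have zz: "cinner z z = 1" using y by (simp add: cinner_self z_def)
    have ez: "cinner e z = 0" "cinner z e = 0" if "e \<in> M" for e
      using orth[OF that] cinner_commute[of y e] by (simp_all add: z_def cinner_simps)
    have "orthonormal (insert z M)"
      using M zz ez by (auto simp: orthonormal_def)
    then have "z \<in> M" using max by blast
    then show False using ez zz by force
  qed
  then show ?thesis using M by (auto simp: is_onb_on_id)
qed


section \<open>Traces against a density operator\<close>

text \<open>One step of a Cholesky decomposition.  For positive \<open>T\<close>, the denominator is zero only if
  \<open>T y = 0\<close>, and then \<open>T\<close> is unchanged.\<close>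

definition deflate :: "('a::chilbert_space \<Rightarrow> 'a) \<Rightarrow> 'a \<Rightarrow> 'a \<Rightarrow> 'a" where
  "deflate T y = (\<lambda>x. T x - (cinner (T y) x / cinner y (T y)) *\<^sub>C T y)"

text \<open>Normalised so that its rank-one operator is the term subtracted by
  \<open>deflate\<close>. For a zero denominator, division by zero yields the zero vector,
  consistent with \<open>T y = 0\<close>.\<close>

definition deflation_vector :: "('a::chilbert_space \<Rightarrow> 'a) \<Rightarrow> 'a \<Rightarrow> 'a" where
  "deflation_vector T y = (1 / sqrt (Re (cinner y (T y)))) *\<^sub>R T y"

lemma deflate_quadratic:
  assumes T: "psd_op T"
  shows "Re (cinner x (deflate T y x)) =
    Re (cinner x (T x)) - (cmod (cinner (deflation_vector T y) x))\<^sup>2"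
proof -
  define q where "q = Re (cinner y (T y))"
  have q: "cinner y (T y) = of_real q" "q \<ge> 0"
    using psd_op_quadratic[OF T, of y] T by (auto simp: q_def psd_op_def)
  have "cinner x (deflate T y x) = cinner x (T x) - of_real ((cmod (cinner (T y) x))\<^sup>2 / q)"
    using cinner_mult_cinner_commute[of "T y" x]
    by (simp add: deflate_def cinner_simps q)
  then show ?thesis
    using q(2)
    by (simp add: deflation_vector_def cinner_simps norm_mult power_mult_distrib q_def[symmetric]
        power_divide norm_divide)
qed

text \<open>Positivity of the remainder is Cauchy-Schwarz for the form of \<open>T\<close> at
  \<open>y\<close> and \<open>x\<close>.\<close>

lemma psd_op_deflate:
  assumes T: "psd_op T"
  shows "psd_op (deflate T y)"
  unfolding psd_op_def
proof (intro conjI allI)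
  have lin: "clinear T" and sym: "\<And>x z. cinner (T x) z = cinner x (T z)"
    using T by (auto simp: psd_op_def)
  define q where "q = Re (cinner y (T y))"
  have q: "cinner y (T y) = of_real q" "q \<ge> 0"
    using psd_op_quadratic[OF T, of y] T by (auto simp: q_def psd_op_def)
  show "clinear (deflate T y)"
    by (auto simp: clinear_def deflate_def cinner_simps clinear_add[OF lin] clinear_scaleC[OF lin]
        add_divide_distrib scaleC_add_left scaleC_add_right algebra_simps cvec.scale_right_diff_distrib)
  show "cinner (deflate T y x) z = cinner x (deflate T y z)" for x z
    by (simp add: deflate_def cinner_simps q sym)
      (metis cinner_commute mult.commute sym)
  show "0 \<le> Re (cinner x (deflate T y x))" for x
  proof (cases "q = 0")
    case True
    then show ?thesis
      using T by (simp add: deflate_quadratic[OF T] deflation_vector_def q_def psd_op_def)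
  next
    case False
    with q have "q > 0" by simp
    have "(cmod (cinner (T y) x))\<^sup>2 \<le> q * Re (cinner x (T x))"
      using psd_op_Cauchy_Schwarz[OF T, of y x] by (simp add: sym q_def)
    then show ?thesis
      using \<open>q > 0\<close>
      by (simp add: deflate_quadratic[OF T] deflation_vector_def cinner_simps norm_mult
          power_mult_distrib q_def[symmetric] power_divide norm_divide pos_divide_le_eq mult.commute)
  qed
qed

lemma deflate_self: "psd_op T \<Longrightarrow> deflate T y y = 0"
proof -
  assume T: "psd_op T"
  then have "cinner (T y) y = cinner y (T y)" by (simp add: psd_op_def)
  then show ?thesis
    using psd_op_kernel[OF T, of y] by (cases "cinner y (T y) = 0") (auto simp: deflate_def)
qed

text \<open>
  The remainders decrease as forms and eventually annihilate every vector of \<open>S\<close>, hence tend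
  to zero.  Only countably many vectors of \<open>S\<close> matter, as the diagonal sum of \<open>\<rho>\<close> converges.
\<close>

lemma psd_op_rank_one_decomposition:
  fixes \<rho> :: "'a::chilbert_space \<Rightarrow> 'a"
  assumes \<rho>: "psd_op \<rho>" "bounded_linear \<rho>" and S: "is_onb_on S id"
    and summable: "(\<lambda>e. cinner e (\<rho> e)) summable_on S"
  shows "\<exists>v :: nat \<Rightarrow> 'a. \<forall>x. ((\<lambda>n. (cmod (cinner (v n) x))\<^sup>2) has_sum Re (cinner x (\<rho> x))) UNIV"
proof -
  \<comment> \<open>Convergence of the diagonal sum leaves countably many nonzero diagonal entries.
    The range of \<open>e\<close> may contain further vectors; deflating along them does no
    harm.\<close>
  obtain e where e: "\<And>f. f \<in> S \<Longrightarrow> cinner f (\<rho> f) \<noteq> 0 \<Longrightarrow> f \<in> range (e :: nat \<Rightarrow> 'a)"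
  proof -
    have "countable {f\<in>S. cinner f (\<rho> f) \<noteq> 0}"
      using summable by (rule summable_countable_complex)
    then obtain e where "{f\<in>S. cinner f (\<rho> f) \<noteq> 0} \<subseteq> range (e :: nat \<Rightarrow> 'a)"
      by (metis (no_types) empty_subsetI range_from_nat_into subset_refl)
    then show thesis by (intro that[of e]) auto
  qed
  define R where "R = rec_nat \<rho> (\<lambda>n T. deflate T (e n))"
  have R0: "R 0 = \<rho>" and RSuc: "R (Suc n) = deflate (R n) (e n)" for n
    by (simp_all add: R_def)
  define v where "v n = deflation_vector (R n) (e n)" for n
  have psd: "psd_op (R n)" for n
    by (induction n) (auto simp: R0 RSuc \<rho> psd_op_deflate)
  have lin: "clinear (R n)" for n using psd by (simp add: psd_op_def)
  have sym: "cinner (R n x) y = cinner x (R n y)" for n x y using psd by (simp add: psd_op_def)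
  have pos: "0 \<le> Re (cinner x (R n x))" for n x using psd by (simp add: psd_op_def)
  have step: "Re (cinner x (R (Suc n) x)) = Re (cinner x (R n x)) - (cmod (cinner (v n) x))\<^sup>2" for n x
    unfolding RSuc v_def by (rule deflate_quadratic[OF psd])
  \<comment> \<open>The losses telescope, so the partial sums miss the target by the form of the
    remainder \<open>R n\<close>.\<close>
  have partial: "(\<Sum>k<n. (cmod (cinner (v k) x))\<^sup>2) = Re (cinner x (\<rho> x)) - Re (cinner x (R n x))" for n x
    by (induction n) (auto simp: R0 step)
  have decr: "Re (cinner x (R n x)) \<le> Re (cinner x (R m x))" if "m \<le> n" for m n x
    using that by (induction rule: dec_induct) (auto simp: step add_increasing2 intro: order_trans[rotated])
  \<comment> \<open>A vector once annihilated stays annihilated: its form is squeezed to zero, and a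
    zero form puts it in the kernel.\<close>
  have kernel: "R n x = 0" if "m \<le> n" "R m x = 0" for m n x
    using decr[OF that(1), of x] pos[of x n] that(2) by (intro psd_op_kernel[OF psd]) simp
  \<comment> \<open>A vector with zero diagonal entry is already in the kernel of \<rho>; any other
    is some \<open>e n\<close> and is killed at stage \<open>Suc n\<close>.\<close>
  have kernel_S: "\<exists>n. R n f = 0" if f: "f \<in> S" for f
  proof (cases "cinner f (\<rho> f) = 0")
    case True
    then have "R 0 f = 0" using psd_op_kernel[OF \<rho>(1)] by (simp add: R0)
    then show ?thesis ..
  next
    case False
    then obtain n where "f = e n" using e f by auto
    then have "R (Suc n) f = 0" using deflate_self[OF psd] by (simp add: RSuc)
    then show ?thesis ..
  qed
  have kernel_span: "\<exists>n. R n y = 0" if y: "y \<in> cspan S" for y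
    using y
  proof (induction rule: cvec.span_induct_alt)
    case base
    show ?case using clinear_zero[OF lin] by blast
  next
    case (step c f y)
    then obtain m n where mn: "R m f = 0" "R n y = 0" using kernel_S by blast
    have "R (max m n) f = 0" "R (max m n) y = 0"
      using kernel[of m "max m n"] kernel[of n "max m n"] mn by auto
    then have "R (max m n) (c *\<^sub>C f + y) = 0"
      by (simp add: clinear_add[OF lin] clinear_scaleC[OF lin])
    then show ?case by blast
  qed
  obtain K where K: "K > 0" "\<And>x. norm (\<rho> x) \<le> norm x * K"
    using bounded_linear.pos_bounded[OF \<rho>(2)] by blast
  have lim: "(\<lambda>n. Re (cinner x (R n x))) \<longlonglongrightarrow> 0" for x
  proof (rule LIMSEQ_I)
    fix r :: real assume "r > 0"
    \<comment> \<open>The radius is chosen so that \<open>K\<close> times its square equals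
      \<open>r\<close>.\<close>
    then have "sqrt (r / K) > 0" using K by simp
    moreover have "x \<in> closure (cspan S)" using S by (simp add: is_onb_on_id)
    ultimately obtain y where y: "y \<in> cspan S" "dist y x < sqrt (r / K)"
      unfolding closure_approachable by blast
    obtain m where m: "R m y = 0" using kernel_span[OF y(1)] by blast
    have "norm (Re (cinner x (R n x)) - 0) < r" if "n \<ge> m" for n
    proof -
      have n: "R n y = 0" using kernel[OF that m] .
      \<comment> \<open>With \<open>y\<close> in the kernel, \<open>x\<close> may be replaced by
        \<open>x - y\<close> on both sides; there the form of \<open>R n\<close> is dominated by
        that of \<rho>, uniformly in \<open>n\<close>.\<close>
      then have "cinner x (R n x) = cinner (x - y) (R n (x - y))"
        using sym[of n y x] by (simp add: clinear_diff[OF lin] cinner_simps)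
      then have "Re (cinner x (R n x)) \<le> Re (cinner (x - y) (\<rho> (x - y)))"
        using decr[of 0 n "x - y"] by (simp add: R0)
      also have "\<dots> \<le> norm (x - y) * norm (\<rho> (x - y))"
        by (rule order_trans[OF complex_Re_le_cmod cmod_cinner_le])
      also have "\<dots> \<le> norm (x - y) * (norm (x - y) * K)"
        using K by (intro mult_left_mono) auto
      also have "\<dots> = (dist y x)\<^sup>2 * K"
        by (simp add: dist_norm norm_minus_commute power2_eq_square)
      also have "\<dots> < (sqrt (r / K))\<^sup>2 * K"
        using y(2) K by (intro mult_strict_right_mono power_strict_mono) auto
      also have "\<dots> = r" using K \<open>r > 0\<close> by simp
      finally show ?thesis using pos[of x n] by simp
    qed
    then show "\<exists>no. \<forall>n\<ge>no. norm (Re (cinner x (R n x)) - 0) < r" by blast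
  qed
  have "((\<lambda>n. (cmod (cinner (v n) x))\<^sup>2) has_sum Re (cinner x (\<rho> x))) UNIV" for x
  proof (rule sums_nonneg_imp_has_sum)
    have "(\<lambda>n. Re (cinner x (\<rho> x)) - Re (cinner x (R n x))) \<longlonglongrightarrow> Re (cinner x (\<rho> x)) - 0"
      by (intro tendsto_diff tendsto_const lim)
    then show "(\<lambda>n. (cmod (cinner (v n) x))\<^sup>2) sums Re (cinner x (\<rho> x))"
      by (simp add: sums_def partial)
  qed simp
  then show ?thesis by blast
qed

section \<open>Traces of a bounded operator times a density operator\<close>

lemma has_trace_unique: "has_trace A c \<Longrightarrow> has_trace A d \<Longrightarrow> c = d"
  using onb_exists has_sum_unique unfolding has_trace_def by blast

lemma ctrace_eqI: "has_trace A c \<Longrightarrow> ctrace A = c"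
  unfolding ctrace_def using has_trace_unique by blast

lemma density_op_psd: "density_op \<rho> \<Longrightarrow> psd_op \<rho>"
  by (auto simp: density_op_def psd_op_def hermitian_op_def bounded_clinear_imp_clinear)

text \<open>Summing the squared moduli of \<open>cinner (v n) e\<close> over \<open>n\<close> first
  gives the diagonal sum of \<rho>, which is finite; summing over \<open>e\<close> first gives, by
  Parseval, the squared norms of \<open>v n\<close>.\<close>

lemma density_op_decomposition:
  fixes \<rho> :: "'a::chilbert_space \<Rightarrow> 'a"
  assumes \<rho>: "density_op \<rho>"
  shows "\<exists>v :: nat \<Rightarrow> 'a. (\<lambda>n. (norm (v n))\<^sup>2) summable_on UNIV \<and>
    (\<forall>x y. ((\<lambda>n. cinner x (v n) * cinner (v n) y) has_sum cinner x (\<rho> y)) UNIV)"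
proof -
  obtain S :: "'a set" where S: "is_onb_on S id" using onb_exists by blast
  have tr: "((\<lambda>e. cinner e (\<rho> e)) has_sum 1) S"
    using \<rho> S by (simp add: density_op_def has_trace_def)
  have bl: "bounded_linear \<rho>"
    using \<rho> by (simp add: density_op_def hermitian_op_def bounded_clinear_def)
  obtain v :: "nat \<Rightarrow> 'a"
    where v: "\<And>x. ((\<lambda>n. (cmod (cinner (v n) x))\<^sup>2) has_sum Re (cinner x (\<rho> x))) UNIV"
    using psd_op_rank_one_decomposition[OF density_op_psd[OF \<rho>] bl S] tr
    unfolding summable_on_def by blast
  have "((\<lambda>e. Re (cinner e (\<rho> e))) has_sum 1) S"
    using has_sum_Re[OF tr] by simp
  then have "(\<lambda>(e, n). (cmod (cinner (v n) e))\<^sup>2) summable_on (S \<times> UNIV)"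
    by (intro summable_on_SigmaI[where g = "\<lambda>e. Re (cinner e (\<rho> e))"])
      (auto simp: v summable_on_def)
  then have "(\<lambda>(n, e). (cmod (cinner (v n) e))\<^sup>2) summable_on (UNIV \<times> S)"
    by (subst summable_on_swap) simp
  then have "(\<lambda>n. \<Sum>\<^sub>\<infinity>e\<in>S. (cmod (cinner (v n) e))\<^sup>2) summable_on UNIV"
    by (rule summable_on_Sigma_banach[where f = "\<lambda>n e. (cmod (cinner (v n) e))\<^sup>2"])
  moreover have "(\<Sum>\<^sub>\<infinity>e\<in>S. (cmod (cinner (v n) e))\<^sup>2) = (norm (v n))\<^sup>2" for n
    using onb_has_sum_norm[OF S, of "v n"] by (simp add: infsumI cmod_cinner_commute[of "v n"])
  ultimately have "(\<lambda>n. (norm (v n))\<^sup>2) summable_on UNIV" by simp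
  then show ?thesis
    using has_sum_polarization[OF density_op_psd[OF \<rho>] v] by blast
qed

text \<open>The adjoint is an explicit witness. Only \<open>A\<close> is required to be bounded, so
  symmetric arguments assume the relation in both directions.\<close>

definition has_adjoint :: "('a::chilbert_space \<Rightarrow> 'b::chilbert_space) \<Rightarrow> ('b \<Rightarrow> 'a) \<Rightarrow> bool" where
  "has_adjoint A A' \<longleftrightarrow> bounded_clinear A \<and> (\<forall>x y. cinner (A' x) y = cinner x (A y))"

text \<open>The double family \<open>?g n e\<close> has row sums
  \<open>cinner (v n) (A (v n))\<close> and column sums \<open>cinner e (A (\<rho> e))\<close>.
  Absolute summability equates the two totals, and the row total does not mention the basis.\<close>

lemma has_trace_compose_density:
  fixes \<rho> A A' :: "'a::chilbert_space \<Rightarrow> 'a"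
  assumes v2: "(\<lambda>n::nat. (norm (v n))\<^sup>2) summable_on UNIV"
    and v: "\<And>x y. ((\<lambda>n. cinner x (v n) * cinner (v n) y) has_sum cinner x (\<rho> y)) UNIV"
    and A: "has_adjoint A A'"
  shows "((\<lambda>n. cinner (v n) (A (v n))) summable_on UNIV) \<and>
    has_trace (A \<circ> \<rho>) (\<Sum>\<^sub>\<infinity>n. cinner (v n) (A (v n)))"
proof -
  let ?g = "\<lambda>n e. cinner (v n) e * cinner e (A (v n))"
  obtain K where K: "K \<ge> 0" "\<And>x. norm (A x) \<le> norm x * K"
    using A bounded_linear.nonneg_bounded[of A] by (auto simp: has_adjoint_def bounded_clinear_def)
  have main: "(\<lambda>n. cinner (v n) (A (v n))) summable_on UNIV \<and>
      ((\<lambda>e. cinner e ((A \<circ> \<rho>) e)) has_sum (\<Sum>\<^sub>\<infinity>n. cinner (v n) (A (v n)))) S"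
    if S: "is_onb_on S id" for S
  proof -
    \<comment> \<open>This family dominates \<open>?g\<close> by \<open>2ab <= a^2 + b^2\<close>;
      its rows sum to at most \<open>1 + K^2\<close> times the squared norm of
      \<open>v n\<close>.\<close>
    have "(\<lambda>(n, e). (cmod (cinner e (v n)))\<^sup>2 + (cmod (cinner e (A (v n))))\<^sup>2) summable_on (UNIV \<times> S)"
    proof (rule summable_on_SigmaI)
      show "((\<lambda>e. case (n, e) of (n, e) \<Rightarrow> (cmod (cinner e (v n)))\<^sup>2 + (cmod (cinner e (A (v n))))\<^sup>2)
          has_sum ((norm (v n))\<^sup>2 + (norm (A (v n)))\<^sup>2)) S" for n
        by (auto intro!: has_sum_add onb_has_sum_norm[OF S])
      have "(\<lambda>n. (norm (v n))\<^sup>2 * (1 + K\<^sup>2)) summable_on UNIV"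
        by (intro summable_on_cmult_left v2)
      then show "(\<lambda>n. (norm (v n))\<^sup>2 + (norm (A (v n)))\<^sup>2) summable_on UNIV"
      proof (rule summable_on_comparison_test)
        show "(norm (v n))\<^sup>2 + (norm (A (v n)))\<^sup>2 \<le> (norm (v n))\<^sup>2 * (1 + K\<^sup>2)" for n
          using power_mono[OF K(2)[of "v n"], of 2] by (simp add: power_mult_distrib algebra_simps)
      qed auto
    qed auto
    then have "(\<lambda>p. norm (case p of (n, e) \<Rightarrow> ?g n e)) summable_on (UNIV \<times> S)"
    proof (rule summable_on_comparison_test)
      fix p :: "nat \<times> 'a" assume "p \<in> UNIV \<times> S"
      obtain n e where p: "p = (n, e)" by fastforce
      have "2 * (cmod (cinner e (v n)) * cmod (cinner e (A (v n)))) \<le>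
          (cmod (cinner e (v n)))\<^sup>2 + (cmod (cinner e (A (v n))))\<^sup>2"
        using sum_squares_bound[of "cmod (cinner e (v n))"] by (simp add: mult.assoc)
      then show "norm (case p of (n, e) \<Rightarrow> ?g n e) \<le>
          (case p of (n, e) \<Rightarrow> (cmod (cinner e (v n)))\<^sup>2 + (cmod (cinner e (A (v n))))\<^sup>2)"
        using mult_nonneg_nonneg[OF norm_ge_zero[of "cinner e (v n)"] norm_ge_zero[of "cinner e (A (v n))"]]
        unfolding p prod.case norm_mult cmod_cinner_commute[of "v n"] by linarith
    qed auto
    then have g: "(\<lambda>(n, e). ?g n e) summable_on (UNIV \<times> S)"
      by (rule abs_summable_summable)
    have rows: "(?g n has_sum cinner (v n) (A (v n))) S" for n
      by (rule onb_has_sum_cinner[OF S])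
    \<comment> \<open>The adjoint moves \<open>A\<close> onto \<open>e\<close>, and the expansion of
      \<rho> applies with left vector \<open>A' e\<close>.\<close>
    have columns: "((\<lambda>n. ?g n e) has_sum cinner e ((A \<circ> \<rho>) e)) UNIV" for e
      using v[of "A' e" e] A by (simp add: has_adjoint_def mult.commute)
    have total: "((\<lambda>(n, e). ?g n e) has_sum (\<Sum>\<^sub>\<infinity>(n, e)\<in>UNIV \<times> S. ?g n e)) (UNIV \<times> S)"
      using g by (rule has_sum_infsum)
    have 1: "((\<lambda>n. cinner (v n) (A (v n))) has_sum (\<Sum>\<^sub>\<infinity>(n, e)\<in>UNIV \<times> S. ?g n e)) UNIV"
      by (rule has_sum_SigmaD[OF total]) (simp add: rows)
    have "((\<lambda>(e, n). ?g n e) has_sum (\<Sum>\<^sub>\<infinity>(n, e)\<in>UNIV \<times> S. ?g n e)) (S \<times> UNIV)"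
      using total by (subst has_sum_swap) simp
    then have 2: "((\<lambda>e. cinner e ((A \<circ> \<rho>) e)) has_sum (\<Sum>\<^sub>\<infinity>(n, e)\<in>UNIV \<times> S. ?g n e)) S"
      by (rule has_sum_SigmaD) (use columns in simp)
    show ?thesis
      using 1 2 by (auto simp: summable_on_def infsumI)
  qed
  show ?thesis
    using main onb_exists by (auto simp: has_trace_def)
qed


section \<open>Rank-one operators and operator exponentials\<close>

text \<open>In any basis the diagonal terms are those of Parseval's expansion of
  \<open>cinner v (X v)\<close>.\<close>

lemma has_trace_compose_ketbra:
  assumes "clinear X"
  shows "has_trace (X \<circ> ketbra v v) (cinner v (X v))"
  unfolding has_trace_def
  using onb_has_sum_cinner[of _ v "X v"]
  by (simp add: ketbra_def clinear_scaleC[OF assms] cinner_scaleC_right)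

lemma cadjoint_eqI:
  assumes "\<And>x y. cinner (A' x) y = cinner x (A y)"
  shows "cadjoint A = A'"
proof
  fix x
  have "\<forall>x y. cinner (cadjoint A x) y = cinner x (A y)"
    unfolding cadjoint_def by (rule someI[of _ A']) (simp add: assms)
  then have "cinner y (cadjoint A x) = cinner y (A' x)" for y
    using assms by (metis cinner_commute)
  then show "cadjoint A x = A' x" by (rule cinner_ext)
qed

lemma cadjoint_ketbra: "cadjoint (ketbra x y) = ketbra y x"
proof (rule cadjoint_eqI)
  show "cinner (ketbra y x z) w = cinner z (ketbra x y w)" for z w
    using cinner_commute[of z x] by (simp add: ketbra_def cinner_scaleC_left cinner_scaleC_right)
qed

lemma clinear_ketbra: "clinear (ketbra x y)"
  by (simp add: clinear_def ketbra_def cinner_simps scaleC_add_left scaleC_scaleC)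

lemma clinear_sum_fun:
  "(\<And>i. i \<in> I \<Longrightarrow> clinear (f i)) \<Longrightarrow> clinear (\<lambda>x. \<Sum>i\<in>I. f i x)"
  by (induction I rule: infinite_finite_induct)
    (auto simp: clinear_def scaleC_add_right algebra_simps)

lemma clinear_scaleC_fun: "clinear f \<Longrightarrow> clinear (\<lambda>x. c *\<^sub>C f x)"
  by (simp add: clinear_def scaleC_add_right scaleC_scaleC mult.commute)

lemma clinear_add_fun: "clinear f \<Longrightarrow> clinear g \<Longrightarrow> clinear (\<lambda>x. f x + g x)"
  by (simp add: clinear_def scaleC_add_right algebra_simps)

lemma clinear_compose: "clinear f \<Longrightarrow> clinear g \<Longrightarrow> clinear (f \<circ> g)"
  by (simp add: clinear_def)

text \<open>Each power acts on a sum of eigenvectors through scalars, so convergence is that of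
  scalar exponential series.\<close>

lemma op_exp_eigenvectors:
  assumes A: "clinear A" and eig: "\<And>i. i \<in> I \<Longrightarrow> A (x i) = a i *\<^sub>C x i"
  shows "op_exp A (\<Sum>i\<in>I. x i) = (\<Sum>i\<in>I. exp (a i) *\<^sub>C x i)"
proof -
  have pow: "(A ^^ n) (\<Sum>i\<in>I. x i) = (\<Sum>i\<in>I. (a i ^ n) *\<^sub>C x i)" for n
  proof (induction n)
    case (Suc n)
    have "(A ^^ Suc n) (\<Sum>i\<in>I. x i) = (\<Sum>i\<in>I. (a i ^ n) *\<^sub>C A (x i))"
      by (simp add: Suc clinear_sum[OF A] clinear_scaleC[OF A])
    also have "\<dots> = (\<Sum>i\<in>I. (a i ^ Suc n) *\<^sub>C x i)"
      by (intro sum.cong refl) (simp add: eig scaleC_scaleC mult.commute)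
    finally show ?case .
  qed simp
  have "(\<lambda>n. (a i ^ n /\<^sub>R fact n) *\<^sub>C x i) sums (exp (a i) *\<^sub>C x i)" for i
    by (rule bounded_linear.sums[OF bounded_linear_scaleC_left exp_converges])
  then have "(\<lambda>n. \<Sum>i\<in>I. (a i ^ n /\<^sub>R fact n) *\<^sub>C x i) sums (\<Sum>i\<in>I. exp (a i) *\<^sub>C x i)"
    by (intro sums_sum)
  moreover have "(\<Sum>i\<in>I. (a i ^ n /\<^sub>R fact n) *\<^sub>C x i) = (1 / fact n) *\<^sub>R (A ^^ n) (\<Sum>i\<in>I. x i)" for n
    unfolding pow scaleR_sum_right
    by (intro sum.cong refl)
      (simp only: scaleR_conv_of_real scaleC_of_real[symmetric] scaleC_scaleC inverse_eq_divide)
  ultimately show ?thesis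
    unfolding op_exp_def using sums_unique by (metis (no_types, lifting) sums_cong)
qed

text \<open>Instantiated with the spectral projections of \<open>H\<close> and with the rank-one
  projections onto the basis of the auxiliary space.\<close>

lemma op_exp_resolution:
  assumes "clinear A" "\<And>x i. i \<in> I \<Longrightarrow> A (P i x) = a i *\<^sub>C P i x" "\<And>x. (\<Sum>i\<in>I. P i x) = x"
  shows "op_exp A = (\<lambda>x. \<Sum>i\<in>I. exp (a i) *\<^sub>C P i x)"
  using op_exp_eigenvectors[of A I "\<lambda>i. P i _" a, OF assms(1) assms(2)]
  by (auto simp: assms(3) fun_eq_iff)


section \<open>Finite orthonormal bases and diagonalised matrices\<close>

lemma is_onb_on_imp_inj_on: "is_onb_on I f \<Longrightarrow> inj_on f I"
  unfolding is_onb_on_def inj_on_def by (metis zero_neq_one)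

lemma is_onb_on_imp_orthonormal:
  assumes "is_onb_on I f"
  shows "orthonormal (f ` I)"
  unfolding orthonormal_def
proof (intro ballI)
  fix e e' assume "e \<in> f ` I" "e' \<in> f ` I"
  then obtain i j where "i \<in> I" "j \<in> I" "e = f i" "e' = f j" by blast
  then show "cinner e e' = (if e = e' then 1 else 0)"
    using assms inj_onD[OF is_onb_on_imp_inj_on[OF assms], of i j]
    by (auto simp: is_onb_on_def)
qed

text \<open>For finite \<open>I\<close>, Parseval's identity makes the distance from
  \<open>x\<close> to its expansion zero.\<close>

lemma finite_onb_expansion:
  assumes onb: "is_onb_on I f" and I: "finite I"
  shows "x = (\<Sum>i\<in>I. cinner (f i) x *\<^sub>C f i)"
proof -
  note inj = is_onb_on_imp_inj_on[OF onb] and S = is_onb_on_imp_orthonormal[OF onb]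
  have "x \<in> closure (cspan (f ` I))"
    using onb by (simp add: is_onb_on_def)
  then have "((\<lambda>e. (cmod (cinner e x))\<^sup>2) has_sum (norm x)\<^sup>2) (f ` I)"
    by (rule Parseval_identity[OF S])
  then have "(\<Sum>e\<in>f ` I. (cmod (cinner e x))\<^sup>2) = (norm x)\<^sup>2"
    using I by (simp add: has_sum_finite_iff)
  then have "(norm (x - (\<Sum>e\<in>f ` I. cinner e x *\<^sub>C e)))\<^sup>2 = 0"
    using norm_diff_orthonormal_sum[OF S, of x "\<lambda>e. cinner e x"] I by simp
  then show ?thesis
    by (simp add: sum.reindex[OF inj])
qed

lemma cdim_finite_onb:
  fixes f :: "'i \<Rightarrow> 'a::chilbert_space"
  assumes onb: "is_onb_on I f" and I: "finite I"
  shows "cdim (UNIV :: 'a set) = card I"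
proof -
  note inj = is_onb_on_imp_inj_on[OF onb] and S = is_onb_on_imp_orthonormal[OF onb]
  have "x \<in> cspan (f ` I)" for x
    by (subst finite_onb_expansion[OF onb I])
      (auto intro!: cvec.span_sum cvec.span_scale intro: cvec.span_base)
  then have "cspan (f ` I) = cspan UNIV"
    by (auto simp: cvec.span_UNIV)
  moreover have "cvec.independent (f ` I)"
  proof (rule cvec.independent_if_scalars_zero)
    show "c e = 0" if "(\<Sum>e\<in>f ` I. c e *\<^sub>C e) = 0" "e \<in> f ` I" for c e
      using cinner_orthonormal_sum[OF S _ that(2), of c] I that(1) by simp
  qed (use I in simp)
  ultimately have "cdim (UNIV :: 'a set) = card (f ` I)"
    by (rule cvec.dim_eq_card)
  then show ?thesis by (simp add: card_image[OF inj])
qed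

section \<open>Unitarily diagonalised matrices: eigenvalues, entries, rank\<close>

lemma scaleC_vec_eq_smult: "c *\<^sub>C (x :: complex ^ 'n) = c *s x"
  by (simp add: scaleC_vec_def scaleC_complex_def vector_scalar_mult_def)

lemma cinner_mat_dagger: "cinner (mat_dagger A *v x) y = cinner x (A *v y)"
  for A :: "complex ^ 'n ^ 'm"
proof -
  have "cinner (mat_dagger A *v x) y = (\<Sum>i\<in>UNIV. \<Sum>j\<in>UNIV. A $ j $ i * cnj (x $ j) * y $ i)"
    by (simp add: cinner_vec_def cinner_complex_def matrix_vector_mult_def mat_dagger_def
        sum_distrib_right)
  also have "\<dots> = (\<Sum>j\<in>UNIV. \<Sum>i\<in>UNIV. A $ j $ i * cnj (x $ j) * y $ i)"
    by (rule sum.swap)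
  also have "\<dots> = cinner x (A *v y)"
    by (simp add: cinner_vec_def cinner_complex_def matrix_vector_mult_def sum_distrib_left
        algebra_simps)
  finally show ?thesis .
qed

lemma diagonal_mat_mult_axis:
  assumes "diagonal_mat D"
  shows "D *v axis l 1 = (D $ l $ l) *s axis l 1"
  using assms
  by (auto simp: diagonal_mat_def vec_eq_iff matrix_vector_mult_basis column_def axis_def
      matrix_vector_mult_def if_distrib[of "\<lambda>x. _ * x"] cong: if_cong)

text \<open>Column \<open>l\<close> of \<open>U\<close> is an eigenvector of \<open>A\<close> with
  eigenvalue \<open>D $ l $ l\<close>. Real nonnegative values are what make \<open>csqrt\<close>
  the ordinary square root in \<open>coupling\<close>.\<close>

lemma psd_diagonalisation_nonneg:
  fixes A U D :: "complex ^ 'n ^ 'n"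
  assumes A: "psd_mat A" "A = U ** D ** mat_dagger U" and U: "unitary_mat U" and D: "diagonal_mat D"
  shows "D $ l $ l = of_real (Re (D $ l $ l))" "0 \<le> Re (D $ l $ l)"
proof -
  define u where "u = U *v axis l 1"
  have inv: "mat_dagger U ** U = mat 1" using U by (simp add: unitary_mat_def)
  have recover: "mat_dagger U *v u = axis l 1"
    by (simp add: u_def matrix_vector_mul_assoc inv)
  have Au: "A *v u = D $ l $ l *\<^sub>C u"
  proof -
    have "A *v u = U *v (D *v (mat_dagger U *v u))"
      by (simp add: A(2) matrix_vector_mul_assoc matrix_mul_assoc)
    also have "\<dots> = D $ l $ l *\<^sub>C u"
      unfolding recover diagonal_mat_mult_axis[OF D] scaleC_vec_eq_smult
      by (simp add: u_def vector_scalar_commute)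
    finally show ?thesis .
  qed
  have "axis l 1 \<noteq> (0 :: complex ^ 'n)" by (simp add: axis_eq_0_iff)
  then have "u \<noteq> 0" using recover by (metis matrix_vector_mult_0_right)
  have "cinner (A *v u) u = cinner u (A *v u)"
    using A(1) cinner_mat_dagger[of A u u] by (simp add: psd_mat_def)
  then have "cnj (D $ l $ l) = D $ l $ l"
    using \<open>u \<noteq> 0\<close> by (simp add: Au cinner_scaleC_left cinner_scaleC_right)
  then show "D $ l $ l = of_real (Re (D $ l $ l))"
    by (simp add: complex_eq_iff)
  have "0 \<le> Re (D $ l $ l * of_real ((norm u)\<^sup>2))"
    using A(1) by (simp only: psd_mat_def Au cinner_scaleC_right cinner_self[symmetric])
      (metis Au cinner_scaleC_right)
  then show "0 \<le> Re (D $ l $ l)"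
    using \<open>u \<noteq> 0\<close> by (simp add: zero_le_mult_iff del: of_real_power)
qed

lemma csqrt_mult_cnj:
  assumes "z = of_real r" "0 \<le> r"
  shows "csqrt z * cnj (csqrt z) = z"
  using assms by (simp flip: of_real_mult)

lemma mult_diagonal_entry:
  assumes "diagonal_mat D"
  shows "(U ** D ** mat_dagger U) $ i $ j = (\<Sum>l\<in>UNIV. U $ i $ l * D $ l $ l * cnj (U $ j $ l))"
proof -
  have "(\<Sum>k\<in>UNIV. U $ i $ k * D $ k $ l) = U $ i $ l * D $ l $ l" for l
  proof -
    have "(\<Sum>k\<in>UNIV. U $ i $ k * D $ k $ l) = (\<Sum>k\<in>UNIV. if k = l then U $ i $ l * D $ l $ l else 0)"
      using assms by (intro sum.cong) (auto simp: diagonal_mat_def)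
    then show ?thesis by simp
  qed
  then show ?thesis
    by (simp add: matrix_matrix_mult_def mat_dagger_def)
qed

text \<open>The row space of \<open>A\<close> is spanned by the rows of \<open>mat_dagger U\<close>
  that belong to nonzero diagonal entries, and the rows of an invertible matrix are
  independent.\<close>

lemma rank_unitary_diagonalisation:
  fixes A U D :: "complex ^ 'n ^ 'n"
  assumes A: "A = U ** D ** mat_dagger U" and U: "unitary_mat U" and D: "diagonal_mat D"
  shows "rank A = card {l. D $ l $ l \<noteq> 0}"
proof -
  define r where "r l = row l (mat_dagger U)" for l
  have indep: "\<forall>i. c i = 0" if "(\<Sum>i\<in>UNIV. c i *s r i) = 0" for c
    using that U matrix_right_invertible_independent_rows[of "mat_dagger U"]
    unfolding unitary_mat_def r_def by blast
  have inj: "inj r"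
  proof (rule injI, rule ccontr)
    fix i j assume "r i = r j" "i \<noteq> j"
    \<comment> \<open>Equal rows at distinct indices would satisfy the relation with coefficients 1
      and -1.\<close>
    define c where "c k = (if k = i then 1 else if k = j then -1 else 0 :: complex)" for k
    have "(\<Sum>k\<in>UNIV. c k *s r k) = (\<Sum>k\<in>{i, j}. c k *s r k)"
      by (intro sum.mono_neutral_right) (auto simp: c_def)
    also have "\<dots> = 0"
      using \<open>i \<noteq> j\<close> \<open>r i = r j\<close> by (simp add: c_def)
    finally show False
      using indep[of c, THEN spec[of _ i]] by (simp add: c_def)
  qed
  let ?L = "{l. D $ l $ l \<noteq> 0}"
  have independent: "vec.independent (r ` ?L)"
  proof (rule vec.independent_if_scalars_zero)
    fix c x assume c: "(\<Sum>x\<in>r ` ?L. c x *s x) = 0" and "x \<in> r ` ?L"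
    then obtain l where l: "x = r l" "l \<in> ?L" by auto
    \<comment> \<open>Independence is known for families over all indices, so the coefficients are
      extended by zero.\<close>
    have "(\<Sum>i\<in>UNIV. (if i \<in> ?L then c (r i) else 0) *s r i) = (\<Sum>i\<in>?L. c (r i) *s r i)"
      by (rule sum.mono_neutral_cong_right) auto
    also have "\<dots> = 0"
      using c by (simp add: sum.reindex[OF inj_on_subset[OF inj]])
    finally have "(if l \<in> ?L then c (r l) else 0) = 0" by (rule indep[THEN spec])
    then show "c x = 0" using l by simp
  qed simp
  have rowA: "row i A = (\<Sum>l\<in>?L. (U $ i $ l * D $ l $ l) *s r l)" for i
  proof -
    have "row i A $ j = (\<Sum>l\<in>?L. (U $ i $ l * D $ l $ l) *s r l) $ j" for j
      unfolding sum_component A row_def vec_lambda_beta mult_diagonal_entry[OF D]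
      by (intro sum.mono_neutral_cong_right) (auto simp: r_def row_def mat_dagger_def)
    then show ?thesis by (simp add: vec_eq_iff)
  qed
  \<comment> \<open>Multiplying by \<open>mat_dagger U\<close> from the left inverts the relation
    \<open>rowA\<close> and yields the reverse inclusion of spans.\<close>
  have "mat_dagger U ** A = D ** mat_dagger U"
    using U by (simp add: A matrix_mul_assoc unitary_mat_def)
  then have recover: "(\<Sum>i\<in>UNIV. mat_dagger U $ l $ i *s row i A) = D $ l $ l *s r l" for l
  proof -
    have "(\<Sum>i\<in>UNIV. mat_dagger U $ l $ i *s row i A) $ j = (D $ l $ l *s r l) $ j" for j
    proof -
      have "(\<Sum>i\<in>UNIV. mat_dagger U $ l $ i *s row i A) $ j = (mat_dagger U ** A) $ l $ j"
        by (simp add: row_def matrix_matrix_mult_def)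
      also have "\<dots> = (\<Sum>k\<in>UNIV. D $ l $ k * mat_dagger U $ k $ j)"
        unfolding \<open>mat_dagger U ** A = D ** mat_dagger U\<close> by (simp add: matrix_matrix_mult_def)
      also have "\<dots> = (\<Sum>k\<in>UNIV. if k = l then D $ l $ l * mat_dagger U $ l $ j else 0)"
        using D by (intro sum.cong) (auto simp: diagonal_mat_def)
      finally show ?thesis by (simp add: r_def row_def)
    qed
    then show ?thesis by (simp add: vec_eq_iff)
  qed
  have "vec.span (r ` ?L) = vec.span (rows A)"
  proof (rule vec.span_eq[THEN iffD2], intro conjI subsetI)
    fix x assume "x \<in> r ` ?L"
    then obtain l where l: "x = r l" "D $ l $ l \<noteq> 0" by auto
    have "x = inverse (D $ l $ l) *s (\<Sum>i\<in>UNIV. mat_dagger U $ l $ i *s row i A)"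
      using l by (simp add: recover)
    then show "x \<in> vec.span (rows A)"
      by (auto simp: rows_def intro!: vec.span_scale vec.span_sum intro: vec.span_base)
  next
    fix x assume "x \<in> rows A"
    then show "x \<in> vec.span (r ` ?L)"
      by (auto simp: rows_def rowA intro!: vec.span_scale vec.span_sum intro: vec.span_base)
  qed
  then have "vec.dim (rows A) = card (r ` ?L)"
    using independent by (rule vec.dim_eq_card)
  then show ?thesis
    by (simp add: row_rank_def_gen card_image[OF inj_on_subset[OF inj]])
qed


section \<open>The auxiliary environment\<close>

lemma finite_mode_labels: "finite J \<Longrightarrow> finite (mode_labels J)"
  and card_mode_labels: "finite J \<Longrightarrow> card (mode_labels J) = 1 + card J"
proof -
  assume J: "finite J"
  have eq: "{Exc \<omega> l |\<omega> l. (\<omega>, l) \<in> J} = (\<lambda>(\<omega>, l). Exc \<omega> l) ` J" by auto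
  have inj: "inj_on (\<lambda>(\<omega>, l). Exc \<omega> l) J" by (auto simp: inj_on_def)
  show "finite (mode_labels J)" using J by (simp add: mode_labels_def eq)
  show "card (mode_labels J) = 1 + card J"
    using J card_image[OF inj] by (simp add: mode_labels_def eq image_iff split_beta)
qed

text \<open>Eigenvalues of the auxiliary Hamiltonian. Its sum runs over excited modes only, which
  leaves the vacuum at zero.\<close>

fun label_energy :: "'b mode_label \<Rightarrow> real" where
  "label_energy Vac = 0"
| "label_energy (Exc \<omega> l) = \<omega>"

lemma aux_coupling_op_eq:
  "aux_coupling_op ket J g \<beta> = (\<lambda>x. \<Sum>(\<omega>, l)\<in>J.
     g \<beta> l \<omega> *\<^sub>C ketbra (ket Vac) (ket (Exc \<omega> l)) x +
     cnj (g \<beta> l \<omega>) *\<^sub>C ketbra (ket (Exc \<omega> l)) (ket Vac) x)"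
  by (simp add: aux_coupling_op_def lowering_def cadjoint_ketbra)

lemma clinear_aux_coupling_op: "clinear (aux_coupling_op ket J g \<beta>)"
  unfolding aux_coupling_op_eq split_beta
  by (intro clinear_sum_fun clinear_add_fun clinear_scaleC_fun clinear_ketbra)

context
  fixes ket :: "'b mode_label \<Rightarrow> 'k::chilbert_space" and J :: "(real \<times> 'b) set"
  assumes onb: "is_onb_on (mode_labels J) ket" and J: "finite J"
begin

lemma cinner_ket:
  "i \<in> mode_labels J \<Longrightarrow> j \<in> mode_labels J \<Longrightarrow> cinner (ket i) (ket j) = (if i = j then 1 else 0)"
  using onb by (simp add: is_onb_on_def)

lemma Vac_in_mode_labels: "Vac \<in> mode_labels J"
  and Exc_in_mode_labels: "(\<omega>, l) \<in> J \<Longrightarrow> Exc \<omega> l \<in> mode_labels J"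
  by (auto simp: mode_labels_def)

text \<open>The vacuum vector is normalised, so raising after lowering collapses to the projection
  onto the excited mode.\<close>

lemma aux_hamiltonian_eq:
  "aux_hamiltonian ket J x = (\<Sum>(\<omega>, l)\<in>J. complex_of_real \<omega> *\<^sub>C cinner (ket (Exc \<omega> l)) x *\<^sub>C ket (Exc \<omega> l))"
  unfolding aux_hamiltonian_def lowering_def cadjoint_ketbra scaleC_of_real
  by (intro sum.cong refl)
    (auto simp: ketbra_def cinner_scaleC_right cinner_ket Vac_in_mode_labels)

lemma clinear_aux_hamiltonian: "clinear (\<lambda>x. c *\<^sub>C aux_hamiltonian ket J x)"
  unfolding aux_hamiltonian_eq split_beta
  by (intro clinear_scaleC_fun clinear_sum_fun clinear_ketbra[unfolded ketbra_def])

lemma aux_hamiltonian_ket: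
  assumes i: "i \<in> mode_labels J"
  shows "aux_hamiltonian ket J (ket i) = complex_of_real (label_energy i) *\<^sub>C ket i"
proof -
  have "aux_hamiltonian ket J (ket i) =
      (\<Sum>p\<in>J. if i = Exc (fst p) (snd p) then complex_of_real (label_energy i) *\<^sub>C ket i else 0)"
    unfolding aux_hamiltonian_eq using i
    by (intro sum.cong) (auto simp: cinner_ket Exc_in_mode_labels)
  also have "\<dots> = complex_of_real (label_energy i) *\<^sub>C ket i"
  proof (cases i)
    case Vac
    then show ?thesis by simp
  next
    case (Exc \<omega> l)
    then have "(\<omega>, l) \<in> J" using i by (auto simp: mode_labels_def)
    have "(\<Sum>p\<in>J. if i = Exc (fst p) (snd p) then complex_of_real (label_energy i) *\<^sub>C ket i else 0) =
        (\<Sum>p\<in>J. if p = (\<omega>, l) then complex_of_real (label_energy i) *\<^sub>C ket i else 0)"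
      by (intro sum.cong) (auto simp: Exc prod_eq_iff)
    then show ?thesis using \<open>(\<omega>, l) \<in> J\<close> J by simp
  qed
  finally show ?thesis .
qed

lemma op_exp_aux_hamiltonian:
  "op_exp (\<lambda>x. c *\<^sub>C aux_hamiltonian ket J x) =
    (\<lambda>x. \<Sum>i\<in>mode_labels J. exp (c * complex_of_real (label_energy i)) *\<^sub>C ketbra (ket i) (ket i) x)"
proof (rule op_exp_resolution[OF clinear_aux_hamiltonian])
  have H: "clinear (aux_hamiltonian ket J)"
    using clinear_aux_hamiltonian[of 1] by simp
  show "c *\<^sub>C aux_hamiltonian ket J (ketbra (ket i) (ket i) x) =
      (c * complex_of_real (label_energy i)) *\<^sub>C ketbra (ket i) (ket i) x"
    if "i \<in> mode_labels J" for x i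
    using that by (simp add: ketbra_def clinear_scaleC[OF H] aux_hamiltonian_ket scaleC_scaleC mult_ac)
  show "(\<Sum>i\<in>mode_labels J. ketbra (ket i) (ket i) x) = x" for x
    using finite_onb_expansion[OF onb finite_mode_labels[OF J], of x] by (simp add: ketbra_def)
qed

lemma clinear_op_exp_aux_hamiltonian: "clinear (op_exp (\<lambda>x. c *\<^sub>C aux_hamiltonian ket J x))"
  unfolding op_exp_aux_hamiltonian
  by (intro clinear_sum_fun clinear_scaleC_fun clinear_ketbra)

lemma op_exp_aux_hamiltonian_ket:
  assumes i: "i \<in> mode_labels J"
  shows "op_exp (\<lambda>x. c *\<^sub>C aux_hamiltonian ket J x) (ket i) =
    exp (c * complex_of_real (label_energy i)) *\<^sub>C ket i"
  using op_exp_eigenvectors[OF clinear_aux_hamiltonian,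
      of "{i}" c ket "\<lambda>i. c * complex_of_real (label_energy i)"] i
  by (simp add: aux_hamiltonian_ket scaleC_scaleC)

lemma aux_coupling_op_Vac:
  "aux_coupling_op ket J g \<beta> (ket Vac) = (\<Sum>(\<omega>, l)\<in>J. cnj (g \<beta> l \<omega>) *\<^sub>C ket (Exc \<omega> l))"
  unfolding aux_coupling_op_eq
  by (intro sum.cong refl)
    (auto simp: ketbra_def cinner_ket Vac_in_mode_labels Exc_in_mode_labels)

lemma aux_coupling_op_Exc:
  assumes "(\<omega>, l) \<in> J"
  shows "aux_coupling_op ket J g \<beta> (ket (Exc \<omega> l)) = g \<beta> l \<omega> *\<^sub>C ket Vac"
proof -
  have "aux_coupling_op ket J g \<beta> (ket (Exc \<omega> l)) =
      (\<Sum>p\<in>J. if p = (\<omega>, l) then g \<beta> l \<omega> *\<^sub>C ket Vac else 0)"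
    unfolding aux_coupling_op_eq using assms
    by (intro sum.cong refl)
      (auto simp: ketbra_def cinner_ket Vac_in_mode_labels Exc_in_mode_labels split: if_splits)
  then show ?thesis using assms J by simp
qed

text \<open>The outer exponentials fix the vacuum. The two inner ones meet on a single excitation
  with exponents \<open>\<i> \<omega> (t - s)\<close> and \<open>- \<i> \<omega> t\<close>, so
  \<open>t\<close> cancels.\<close>

lemma aux_correlation:
  "ctrace (heisenberg (aux_hamiltonian ket J) (aux_coupling_op ket J g \<beta>) t \<circ>
      heisenberg (aux_hamiltonian ket J) (aux_coupling_op ket J g \<beta>') (t - s) \<circ> aux_state ket) =
    (\<Sum>(\<omega>, l)\<in>J. exp (- \<i> * of_real (\<omega> * s)) * (g \<beta> l \<omega> * cnj (g \<beta>' l \<omega>)))"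
proof -
  let ?W = "\<lambda>c. op_exp (\<lambda>x. c *\<^sub>C aux_hamiltonian ket J x)"
  let ?B = "aux_coupling_op ket J g"
  define X where "X = heisenberg (aux_hamiltonian ket J) (?B \<beta>) t \<circ>
      heisenberg (aux_hamiltonian ket J) (?B \<beta>') (t - s)"
  have W: "clinear (?W c)" for c by (rule clinear_op_exp_aux_hamiltonian)
  have B: "clinear (?B \<beta>)" for \<beta> by (rule clinear_aux_coupling_op)
  have "clinear X"
    unfolding X_def heisenberg_def by (intro clinear_compose W B)
  then have "ctrace (X \<circ> aux_state ket) = cinner (ket Vac) (X (ket Vac))"
    unfolding aux_state_def by (intro ctrace_eqI has_trace_compose_ketbra)
  moreover have "X (ket Vac) =
      (\<Sum>(\<omega>, l)\<in>J. exp (- \<i> * of_real (\<omega> * s)) * (g \<beta> l \<omega> * cnj (g \<beta>' l \<omega>))) *\<^sub>C ket Vac"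
  proof -
    have W_Vac: "?W c (ket Vac) = ket Vac" for c
      by (simp add: op_exp_aux_hamiltonian_ket Vac_in_mode_labels)
    have "?B \<beta> (?W (- \<i> * of_real t) (?W (\<i> * of_real (t - s)) (?B \<beta>' (ket Vac)))) =
       (\<Sum>(\<omega>, l)\<in>J. (exp (- \<i> * of_real (\<omega> * s)) * (g \<beta> l \<omega> * cnj (g \<beta>' l \<omega>))) *\<^sub>C ket Vac)"
      unfolding aux_coupling_op_Vac clinear_sum[OF W] clinear_sum[OF B]
    proof (intro sum.cong refl, clarify)
      fix \<omega> l assume "(\<omega>, l) \<in> J"
      have phase: "exp (- \<i> * of_real (\<omega> * s)) =
          exp (\<i> * of_real (t - s) * of_real \<omega>) * exp (- \<i> * of_real t * of_real \<omega>)"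
        unfolding mult_exp_exp by (simp add: algebra_simps)
      show "?B \<beta> (?W (- \<i> * of_real t) (?W (\<i> * of_real (t - s)) (cnj (g \<beta>' l \<omega>) *\<^sub>C ket (Exc \<omega> l)))) =
          (exp (- \<i> * of_real (\<omega> * s)) * (g \<beta> l \<omega> * cnj (g \<beta>' l \<omega>))) *\<^sub>C ket Vac"
        unfolding phase clinear_scaleC[OF W] clinear_scaleC[OF B]
          op_exp_aux_hamiltonian_ket[OF Exc_in_mode_labels[OF \<open>(\<omega>, l) \<in> J\<close>]]
          aux_coupling_op_Exc[OF \<open>(\<omega>, l) \<in> J\<close>] scaleC_scaleC label_energy.simps
        by (simp only: mult_ac)
    qed
    then show ?thesis
      unfolding X_def heisenberg_def o_apply W_Vac
      by (simp only: clinear_scaleC[OF W] W_Vac case_prod_unfold cvec.scale_sum_left[symmetric])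
  qed
  ultimately show ?thesis
    by (simp add: X_def cinner_scaleC_right cinner_ket Vac_in_mode_labels)
qed

end


section \<open>Adjointable operators and traces\<close>

lemma hermitian_op_has_adjoint: "hermitian_op A \<Longrightarrow> has_adjoint A A"
  by (simp add: hermitian_op_def has_adjoint_def)

lemma has_adjoint_zero: "has_adjoint (\<lambda>x. 0) (\<lambda>x. 0)"
  by (simp add: has_adjoint_def bounded_clinear_def)

lemma has_adjoint_add:
  "has_adjoint A A' \<Longrightarrow> has_adjoint B B' \<Longrightarrow> has_adjoint (\<lambda>x. A x + B x) (\<lambda>x. A' x + B' x)"
  by (auto simp: has_adjoint_def bounded_clinear_def bounded_linear_add cinner_add_left
      cinner_add_right scaleC_add_right)

lemma has_adjoint_scaleC:
  "has_adjoint A A' \<Longrightarrow> has_adjoint (\<lambda>x. c *\<^sub>C A x) (\<lambda>x. cnj c *\<^sub>C A' x)"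
  using bounded_linear_compose[OF bounded_linear_scaleC_right, of A c]
  by (auto simp: has_adjoint_def bounded_clinear_def cinner_scaleC_left
      cinner_scaleC_right scaleC_scaleC mult.commute)

lemma has_adjoint_sum:
  "(\<And>i. i \<in> I \<Longrightarrow> has_adjoint (A i) (A' i)) \<Longrightarrow>
    has_adjoint (\<lambda>x. \<Sum>i\<in>I. A i x) (\<lambda>x. \<Sum>i\<in>I. A' i x)"
  by (induction I rule: infinite_finite_induct) (auto simp: has_adjoint_zero has_adjoint_add)

lemma has_adjoint_compose:
  "has_adjoint A A' \<Longrightarrow> has_adjoint B B' \<Longrightarrow> has_adjoint (\<lambda>x. A (B x)) (\<lambda>x. B' (A' x))"
  by (auto simp: has_adjoint_def bounded_clinear_def intro: bounded_linear_compose)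

lemma has_adjoint_clinear: "has_adjoint A A' \<Longrightarrow> clinear A"
  by (simp add: has_adjoint_def bounded_clinear_imp_clinear)

lemma cadjoint_has_adjoint: "has_adjoint A A' \<Longrightarrow> cadjoint A = A'"
  by (intro cadjoint_eqI) (simp add: has_adjoint_def)

section \<open>Linearity, conjugation, positivity and unitary invariance of traces\<close>

lemma has_trace_zero: "has_trace (\<lambda>x. 0) 0"
  by (simp add: has_trace_def)

text \<open>Stated for \<open>has_trace\<close>, because linearity of \<open>ctrace\<close>
  presupposes that the traces exist.\<close>

lemma has_trace_linear_combination:
  assumes "\<And>i. i \<in> I \<Longrightarrow> has_trace (A i) (c i)"
  shows "has_trace (\<lambda>x. \<Sum>i\<in>I. a i *\<^sub>C A i x) (\<Sum>i\<in>I. a i * c i)"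
  using assms
proof (induction I rule: infinite_finite_induct)
  case (insert i I)
  then have "has_trace (A i) (c i)" "has_trace (\<lambda>x. \<Sum>i\<in>I. a i *\<^sub>C A i x) (\<Sum>i\<in>I. a i * c i)"
    by auto
  then show ?case
    unfolding has_trace_def sum.insert[OF insert.hyps] cinner_add_right cinner_scaleC_right
    by (intro allI impI has_sum_add has_sum_cmult_right) auto
qed (simp_all add: has_trace_zero)

lemma has_trace_density:
  assumes \<rho>: "density_op \<rho>" and A: "has_adjoint A A'"
  shows "has_trace (A \<circ> \<rho>) (ctrace (A \<circ> \<rho>))"
proof -
  obtain v where "(\<lambda>n::nat. (norm (v n))\<^sup>2) summable_on UNIV"
    and "\<And>x y. ((\<lambda>n. cinner x (v n) * cinner (v n) y) has_sum cinner x (\<rho> y)) UNIV"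
    using density_op_decomposition[OF \<rho>] by blast
  then have "has_trace (A \<circ> \<rho>) (\<Sum>\<^sub>\<infinity>n. cinner (v n) (A (v n)))"
    using has_trace_compose_density[OF _ _ A] by blast
  then show ?thesis by (simp add: ctrace_eqI)
qed

text \<open>In the expansion along \<open>v n\<close>, conjugation acts term by term.\<close>

lemma ctrace_density_adjoint:
  assumes \<rho>: "density_op \<rho>" and A: "has_adjoint A A'" "has_adjoint A' A"
  shows "ctrace (A' \<circ> \<rho>) = cnj (ctrace (A \<circ> \<rho>))"
proof -
  obtain v where v2: "(\<lambda>n::nat. (norm (v n))\<^sup>2) summable_on UNIV"
    and v: "\<And>x y. ((\<lambda>n. cinner x (v n) * cinner (v n) y) has_sum cinner x (\<rho> y)) UNIV"
    using density_op_decomposition[OF \<rho>] by blast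
  have "cinner (v n) (A' (v n)) = cnj (cinner (v n) (A (v n)))" for n
    using A(1) cinner_commute[of "v n" "A' (v n)"] by (simp add: has_adjoint_def)
  then have "(\<Sum>\<^sub>\<infinity>n. cinner (v n) (A' (v n))) = cnj (\<Sum>\<^sub>\<infinity>n. cinner (v n) (A (v n)))"
    by (simp flip: infsum_cnj)
  moreover have "ctrace (A' \<circ> \<rho>) = (\<Sum>\<^sub>\<infinity>n. cinner (v n) (A' (v n)))"
    using has_trace_compose_density[OF v2 v A(2)] by (blast intro: ctrace_eqI)
  moreover have "ctrace (A \<circ> \<rho>) = (\<Sum>\<^sub>\<infinity>n. cinner (v n) (A (v n)))"
    using has_trace_compose_density[OF v2 v A(1)] by (blast intro: ctrace_eqI)
  ultimately show ?thesis by simp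
qed

text \<open>In the expansion along \<open>v n\<close>, each term is the squared norm of
  \<open>A' (v n)\<close>.\<close>

lemma ctrace_density_nonneg:
  assumes \<rho>: "density_op \<rho>" and A: "has_adjoint A A'" "has_adjoint A' A"
  shows "0 \<le> Re (ctrace (A \<circ> A' \<circ> \<rho>))"
proof -
  obtain v where v2: "(\<lambda>n::nat. (norm (v n))\<^sup>2) summable_on UNIV"
    and v: "\<And>x y. ((\<lambda>n. cinner x (v n) * cinner (v n) y) has_sum cinner x (\<rho> y)) UNIV"
    using density_op_decomposition[OF \<rho>] by blast
  have eq: "cinner (v n) ((A \<circ> A') (v n)) = of_real ((norm (A' (v n)))\<^sup>2)" for n
    using A(1) by (simp add: has_adjoint_def cinner_self[symmetric] del: of_real_power)
  have AA: "has_adjoint (A \<circ> A') (A \<circ> A')"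
    using has_adjoint_compose[OF A] by (simp add: comp_def)
  note tr = has_trace_compose_density[OF v2 v AA]
  have "Re (\<Sum>\<^sub>\<infinity>n. cinner (v n) ((A \<circ> A') (v n))) = (\<Sum>\<^sub>\<infinity>n. Re (cinner (v n) ((A \<circ> A') (v n))))"
    by (rule infsum_Re[OF tr[THEN conjunct1], symmetric])
  also have "\<dots> \<ge> 0"
    by (intro infsum_nonneg) (simp add: eq del: o_apply)
  also have "(\<Sum>\<^sub>\<infinity>n. cinner (v n) ((A \<circ> A') (v n))) = ctrace (A \<circ> A' \<circ> \<rho>)"
    using tr by (blast intro: ctrace_eqI[symmetric])
  finally show ?thesis .
qed

text \<open>A self-adjoint involution is unitary: it preserves inner products, and being continuous
  and onto it carries a dense span to a dense span.\<close>

lemma onb_image_involution: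
  fixes V :: "'a::chilbert_space \<Rightarrow> 'a"
  assumes V: "hermitian_op V" "\<And>x. V (V x) = x" and S: "is_onb_on S id"
  shows "is_onb_on (V ` S) id"
proof -
  have sym: "cinner (V x) y = cinner x (V y)" for x y using V(1) by (simp add: hermitian_op_def)
  have lin: "clinear V" and bl: "bounded_linear V"
    using V(1) by (auto simp: hermitian_op_def bounded_clinear_imp_clinear bounded_clinear_def)
  have "orthonormal (V ` S)"
    using S V(2) unfolding is_onb_on_id orthonormal_def by (auto simp: sym) (metis V(2))+
  moreover have "V x \<in> cspan (V ` S)" if "x \<in> cspan S" for x
    using that
    by (induction rule: cvec.span_induct_alt)
      (auto simp: clinear_zero[OF lin] clinear_add[OF lin] clinear_scaleC[OF lin] cvec.span_zero
        intro!: cvec.span_add cvec.span_scale intro: cvec.span_base)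
  then have "V ` closure (cspan S) \<subseteq> closure (cspan (V ` S))"
    by (intro order_trans[OF closure_bounded_linear_image_subset[OF bl] closure_mono]) auto
  then have "x \<in> closure (cspan (V ` S))" for x
    using S V(2)[of x] unfolding is_onb_on_id by (metis UNIV_I image_subset_iff)
  ultimately show ?thesis by (auto simp: is_onb_on_id)
qed

text \<open>The trace of \<open>A\<close> is evaluated in the image basis, and \<open>V\<close> is
  moved across the inner product.\<close>

lemma has_trace_conj_involution:
  fixes V :: "'a::chilbert_space \<Rightarrow> 'a"
  assumes V: "hermitian_op V" "\<And>x. V (V x) = x" and A: "has_trace A c"
  shows "has_trace (\<lambda>x. V (A (V x))) c"
  unfolding has_trace_def
proof (intro allI impI)
  fix S :: "'a set" assume S: "is_onb_on S id"
  have "((\<lambda>e. cinner e (A e)) has_sum c) (V ` S)"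
    using A onb_image_involution[OF V S] by (simp add: has_trace_def)
  moreover have "inj_on V S" using V(2) by (metis inj_onI)
  ultimately have "((\<lambda>e. cinner (V e) (A (V e))) has_sum c) S"
    by (simp add: has_sum_reindex o_def)
  then show "((\<lambda>e. cinner e (V (A (V e)))) has_sum c) S"
    using V(1) by (simp add: hermitian_op_def)
qed


section \<open>Frequency components\<close>

lemma uminus_transition_freqs: "uminus ` transition_freqs E = transition_freqs E"
  by (force simp: transition_freqs_def image_iff)

lemma finite_transition_freqs:
  assumes "finite E"
  shows "finite (transition_freqs E)"
proof -
  have "transition_freqs E = (\<lambda>(\<epsilon>, \<epsilon>'). \<epsilon>' - \<epsilon>) ` (E \<times> E)"
    by (auto simp: transition_freqs_def)
  then show ?thesis using assms by simp
qed

context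
  fixes H :: "'h::chilbert_space \<Rightarrow> 'h" and E P
  assumes spec: "spectral_decomposition H E P"
begin

lemma finite_E: "finite E"
  and P_hermitian: "\<epsilon> \<in> E \<Longrightarrow> hermitian_op (P \<epsilon>)"
  and P_sum: "(\<Sum>\<epsilon>\<in>E. P \<epsilon> x) = x"
  and H_eq: "H x = (\<Sum>\<epsilon>\<in>E. \<epsilon> *\<^sub>R P \<epsilon> x)"
  using spec by (auto simp: spectral_decomposition_def ortho_projection_def)

lemma P_P: "\<epsilon> \<in> E \<Longrightarrow> \<epsilon>' \<in> E \<Longrightarrow> P \<epsilon> (P \<epsilon>' x) = (if \<epsilon> = \<epsilon>' then P \<epsilon> x else 0)"
  using spec unfolding spectral_decomposition_def ortho_projection_def
  by (metis comp_apply)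

lemma P_adjoint: "\<epsilon> \<in> E \<Longrightarrow> has_adjoint (P \<epsilon>) (P \<epsilon>)"
  by (rule hermitian_op_has_adjoint[OF P_hermitian])

lemma clinear_P: "\<epsilon> \<in> E \<Longrightarrow> clinear (P \<epsilon>)"
  by (rule has_adjoint_clinear[OF P_adjoint])

lemma clinear_H: "clinear (\<lambda>x. c *\<^sub>C H x)"
  unfolding H_eq scaleC_of_real[symmetric]
  by (intro clinear_scaleC_fun clinear_sum_fun clinear_P)

lemma H_P: "\<epsilon> \<in> E \<Longrightarrow> H (P \<epsilon> x) = complex_of_real \<epsilon> *\<^sub>C P \<epsilon> x"
proof -
  assume \<epsilon>: "\<epsilon> \<in> E"
  have "H (P \<epsilon> x) = (\<Sum>\<epsilon>'\<in>E. if \<epsilon>' = \<epsilon> then complex_of_real \<epsilon> *\<^sub>C P \<epsilon> x else 0)"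
    unfolding H_eq using \<epsilon> by (intro sum.cong) (auto simp: P_P scaleC_of_real)
  then show ?thesis using \<epsilon> finite_E by simp
qed

lemma P_H: "\<epsilon> \<in> E \<Longrightarrow> P \<epsilon> (H x) = complex_of_real \<epsilon> *\<^sub>C P \<epsilon> x"
proof -
  assume \<epsilon>: "\<epsilon> \<in> E"
  have "P \<epsilon> (H x) = (\<Sum>\<epsilon>'\<in>E. if \<epsilon>' = \<epsilon> then complex_of_real \<epsilon> *\<^sub>C P \<epsilon> x else 0)"
    unfolding H_eq clinear_sum[OF clinear_P[OF \<epsilon>]] scaleC_of_real[symmetric]
      clinear_scaleC[OF clinear_P[OF \<epsilon>]]
    using \<epsilon> by (intro sum.cong) (auto simp: P_P)
  then show ?thesis using \<epsilon> finite_E by simp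
qed

lemma op_exp_H:
  "op_exp (\<lambda>x. c *\<^sub>C H x) = (\<lambda>x. \<Sum>\<epsilon>\<in>E. exp (c * complex_of_real \<epsilon>) *\<^sub>C P \<epsilon> x)"
  by (rule op_exp_resolution[OF clinear_H]) (auto simp: H_P scaleC_scaleC P_sum)

text \<open>The exponentials act as scalars on the ranges of the projections; the block of
  \<open>A\<close> from \<epsilon>' to \<epsilon> acquires a phase that depends on the difference
  alone, so blocks of equal frequency can be grouped.\<close>

lemma heisenberg_freq_components:
  assumes A: "clinear A"
  shows "heisenberg H A t x =
    (\<Sum>\<omega>\<in>transition_freqs E. exp (- \<i> * of_real (\<omega> * t)) *\<^sub>C freq_component E P A \<omega> x)"
proof -
  let ?h = "\<lambda>(\<epsilon>, \<epsilon>'). exp (- \<i> * of_real ((\<epsilon>' - \<epsilon>) * t)) *\<^sub>C P \<epsilon> (A (P \<epsilon>' x))"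
  have "heisenberg H A t x = (\<Sum>\<epsilon>\<in>E. \<Sum>\<epsilon>'\<in>E. ?h (\<epsilon>, \<epsilon>'))"
    unfolding heisenberg_def op_exp_H o_apply
  proof (intro sum.cong refl)
    fix \<epsilon> assume \<epsilon>: "\<epsilon> \<in> E"
    have "exp (\<i> * of_real t * of_real \<epsilon>) *\<^sub>C exp (- \<i> * of_real t * of_real \<epsilon>') *\<^sub>C P \<epsilon> (A (P \<epsilon>' x)) = ?h (\<epsilon>, \<epsilon>')" for \<epsilon>'
      unfolding scaleC_scaleC mult_exp_exp by (simp add: algebra_simps)
    then show "exp (\<i> * of_real t * of_real \<epsilon>) *\<^sub>C P \<epsilon> (A (\<Sum>\<epsilon>'\<in>E. exp (- \<i> * of_real t * of_real \<epsilon>') *\<^sub>C P \<epsilon>' x)) =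
        (\<Sum>\<epsilon>'\<in>E. ?h (\<epsilon>, \<epsilon>'))"
      by (simp only: clinear_sum[OF A] clinear_scaleC[OF A] clinear_sum[OF clinear_P[OF \<epsilon>]]
          clinear_scaleC[OF clinear_P[OF \<epsilon>]] cvec.scale_sum_right)
  qed
  also have "\<dots> = sum ?h (E \<times> E)"
    by (simp add: sum.cartesian_product)
  also have "\<dots> = (\<Sum>\<omega>\<in>transition_freqs E. \<Sum>p | p \<in> E \<times> E \<and> (case p of (\<epsilon>, \<epsilon>') \<Rightarrow> \<epsilon>' - \<epsilon>) = \<omega>. ?h p)"
    by (rule sum.group[symmetric])
      (use finite_E finite_transition_freqs[OF finite_E] in \<open>auto simp: transition_freqs_def\<close>)
  also have "\<dots> = (\<Sum>\<omega>\<in>transition_freqs E. exp (- \<i> * of_real (\<omega> * t)) *\<^sub>C freq_component E P A \<omega> x)"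
    unfolding freq_component_def cvec.scale_sum_right
    by (intro sum.cong refl) auto
  finally show ?thesis .
qed

text \<open>The set of frequencies is symmetric, so the expansion may run over negated ones. For
  Hermitian \<open>A\<close> its summands then contain adjoints of frequency components.\<close>

lemma heisenberg_freq_components':
  assumes A: "clinear A"
  shows "heisenberg H A t x =
    (\<Sum>\<omega>\<in>transition_freqs E. exp (\<i> * of_real (\<omega> * t)) *\<^sub>C freq_component E P A (- \<omega>) x)"
proof -
  have "heisenberg H A t x =
    (\<Sum>\<omega>\<in>uminus ` transition_freqs E. exp (- \<i> * of_real (\<omega> * t)) *\<^sub>C freq_component E P A \<omega> x)"
    unfolding uminus_transition_freqs by (rule heisenberg_freq_components[OF A])
  also have "\<dots> = (\<Sum>\<omega>\<in>transition_freqs E. exp (\<i> * of_real (\<omega> * t)) *\<^sub>C freq_component E P A (- \<omega>) x)"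
    by (subst sum.reindex) auto
  finally show ?thesis .
qed

text \<open>Adjunction exchanges the two projections and thereby negates the frequency; this
  identifies the \<open>cadjoint\<close> in \<open>corr_mat\<close>.\<close>

lemma freq_component_adjoint:
  assumes A: "hermitian_op A"
  shows "has_adjoint (freq_component E P A \<omega>) (freq_component E P A (- \<omega>))"
proof -
  let ?I = "{(\<epsilon>, \<epsilon>'). \<epsilon> \<in> E \<and> \<epsilon>' \<in> E \<and> \<epsilon>' - \<epsilon> = \<omega>}"
  have "has_adjoint (\<lambda>x. \<Sum>p\<in>?I. P (fst p) (A (P (snd p) x))) (\<lambda>x. \<Sum>p\<in>?I. P (snd p) (A (P (fst p) x)))"
  proof (rule has_adjoint_sum)
    show "has_adjoint (\<lambda>x. P (fst p) (A (P (snd p) x))) (\<lambda>x. P (snd p) (A (P (fst p) x)))"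
      if "p \<in> ?I" for p
      using that
      by (intro has_adjoint_compose[OF has_adjoint_compose[OF P_adjoint hermitian_op_has_adjoint[OF A]]
            P_adjoint]) auto
  qed
  moreover have "(\<Sum>p\<in>?I. P (snd p) (A (P (fst p) x))) = freq_component E P A (- \<omega>) x" for x
    unfolding freq_component_def
    by (rule sum.reindex_bij_witness[of _ prod.swap prod.swap]) auto
  ultimately show ?thesis
    by (simp add: freq_component_def split_beta)
qed

lemma corr_mat_entry:
  assumes "\<And>\<beta>. hermitian_op (B \<beta>)"
  shows "corr_mat E P B \<rho> \<omega> $ \<beta> $ \<beta>' =
    ctrace (freq_component E P (B \<beta>) \<omega> \<circ> freq_component E P (B \<beta>') (- \<omega>) \<circ> \<rho>)"
  by (simp add: corr_mat_def cadjoint_has_adjoint[OF freq_component_adjoint[OF assms]])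

text \<open>The quadratic form at \<open>x\<close> is
  \<open>ctrace (Y \<circ> Z \<circ> \<rho>)\<close>, where \<open>Y\<close> combines the frequency
  components with weights \<open>cnj (x $ \<beta>)\<close> and \<open>Z\<close> is the adjoint of
  \<open>Y\<close>.\<close>

lemma psd_corr_mat:
  fixes B :: "'b::finite \<Rightarrow> 'h \<Rightarrow> 'h"
  assumes rho: "density_op \<rho>" and B: "\<And>\<beta>. hermitian_op (B \<beta>)"
  shows "psd_mat (corr_mat E P B \<rho> \<omega>)"
  unfolding psd_mat_def
proof (intro conjI allI)
  let ?F = "\<lambda>\<beta>. freq_component E P (B \<beta>) \<omega>" and ?G = "\<lambda>\<beta>. freq_component E P (B \<beta>) (- \<omega>)"
  have FG: "has_adjoint (?F \<beta>) (?G \<beta>)" "has_adjoint (?G \<beta>) (?F \<beta>)" for \<beta>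
    using freq_component_adjoint[OF B, of \<beta> \<omega>] freq_component_adjoint[OF B, of \<beta> "- \<omega>"] by auto
  have comp: "has_adjoint (?F \<beta> \<circ> ?G \<beta>') (?F \<beta>' \<circ> ?G \<beta>)" for \<beta> \<beta>'
    using has_adjoint_compose[OF FG(1)[of \<beta>] FG(2)[of \<beta>']] by (simp add: comp_def)
  show "mat_dagger (corr_mat E P B \<rho> \<omega>) = corr_mat E P B \<rho> \<omega>"
    unfolding vec_eq_iff mat_dagger_def vec_lambda_beta corr_mat_entry[OF B]
    using ctrace_density_adjoint[OF rho comp comp] by metis
  show "0 \<le> Re (cinner x (corr_mat E P B \<rho> \<omega> *v x))" for x
  proof -
    define Y where "Y = (\<lambda>z. \<Sum>\<beta>\<in>UNIV. cnj (x $ \<beta>) *\<^sub>C ?F \<beta> z)"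
    define Z where "Z = (\<lambda>z. \<Sum>\<beta>\<in>UNIV. x $ \<beta> *\<^sub>C ?G \<beta> z)"
    have YZ: "has_adjoint Y Z" "has_adjoint Z Y"
      unfolding Y_def Z_def
      using has_adjoint_scaleC[OF FG(1), of "cnj (x $ _)"] has_adjoint_scaleC[OF FG(2), of "x $ _"]
      by (auto intro!: has_adjoint_sum)
    have "Y \<circ> Z \<circ> \<rho> = (\<lambda>z. \<Sum>\<beta>\<in>UNIV. cnj (x $ \<beta>) *\<^sub>C (\<Sum>\<beta>'\<in>UNIV. x $ \<beta>' *\<^sub>C (?F \<beta> \<circ> ?G \<beta>' \<circ> \<rho>) z))"
      by (simp add: Y_def Z_def fun_eq_iff clinear_sum[OF has_adjoint_clinear[OF FG(1)]]
          clinear_scaleC[OF has_adjoint_clinear[OF FG(1)]])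
    then have "has_trace (Y \<circ> Z \<circ> \<rho>)
        (\<Sum>\<beta>\<in>UNIV. cnj (x $ \<beta>) * (\<Sum>\<beta>'\<in>UNIV. x $ \<beta>' * ctrace (?F \<beta> \<circ> ?G \<beta>' \<circ> \<rho>)))"
      by (simp only:) (intro has_trace_linear_combination has_trace_density[OF rho comp])
    then have "ctrace (Y \<circ> Z \<circ> \<rho>) =
        (\<Sum>\<beta>\<in>UNIV. cnj (x $ \<beta>) * (\<Sum>\<beta>'\<in>UNIV. x $ \<beta>' * ctrace (?F \<beta> \<circ> ?G \<beta>' \<circ> \<rho>)))"
      by (rule ctrace_eqI)
    also have "\<dots> = cinner x (corr_mat E P B \<rho> \<omega> *v x)"
      by (simp add: cinner_vec_def cinner_complex_def matrix_vector_mult_def corr_mat_entry[OF B]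
          mult.commute)
    finally show ?thesis
      using ctrace_density_nonneg[OF rho YZ] by simp
  qed
qed

section \<open>Stationary states and the environment correlation function\<close>

context
  fixes \<rho>
  assumes rho: "density_op \<rho>" and stationary: "H \<circ> \<rho> = \<rho> \<circ> H"
begin

text \<open>Moving \<open>H\<close> across \<rho> between \<open>P \<delta>\<close> and
  \<open>P \<epsilon>\<close> produces the factor \<delta> on one side and \<epsilon> on the other,
  so the off-diagonal blocks of \<rho> vanish.\<close>

lemma P_rho_commute:
  assumes \<epsilon>: "\<epsilon> \<in> E"
  shows "P \<epsilon> (\<rho> x) = \<rho> (P \<epsilon> x)"
proof -
  have lin: "clinear \<rho>" using density_op_psd[OF rho] by (simp add: psd_op_def)
  have off: "P \<delta> (\<rho> (P \<epsilon> x)) = 0" if "\<delta> \<in> E" "\<epsilon> \<in> E" "\<delta> \<noteq> \<epsilon>" for \<delta> \<epsilon> x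
  proof -
    have "complex_of_real \<delta> *\<^sub>C P \<delta> (\<rho> (P \<epsilon> x)) = P \<delta> (H (\<rho> (P \<epsilon> x)))"
      using that by (simp add: P_H)
    also have "H (\<rho> (P \<epsilon> x)) = \<rho> (H (P \<epsilon> x))"
      using stationary by (metis comp_apply)
    also have "P \<delta> \<dots> = complex_of_real \<epsilon> *\<^sub>C P \<delta> (\<rho> (P \<epsilon> x))"
      using that by (simp add: H_P clinear_scaleC[OF lin] clinear_scaleC[OF clinear_P])
    finally show ?thesis
      using that by (simp add: cvec.scale_cancel_right)
  qed
  have "P \<epsilon> (\<rho> x) = P \<epsilon> (\<rho> (\<Sum>\<delta>\<in>E. P \<delta> x))" by (simp add: P_sum)
  also have "\<dots> = (\<Sum>\<delta>\<in>E. P \<epsilon> (\<rho> (P \<delta> x)))"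
    by (simp only: clinear_sum[OF lin] clinear_sum[OF clinear_P[OF \<epsilon>]])
  \<comment> \<open>Only the summand with \<delta> = \<epsilon> can be nonzero on either side, so
    the two projections may trade places.\<close>
  also have "\<dots> = (\<Sum>\<delta>\<in>E. P \<delta> (\<rho> (P \<epsilon> x)))"
    using off \<epsilon> by (intro sum.cong refl) metis
  also have "\<dots> = \<rho> (P \<epsilon> x)" by (rule P_sum)
  finally show ?thesis .
qed

text \<open>Conjugating with the reflection \<open>1 - 2 P \<epsilon>\<close> preserves the trace but flips the sign of
  the operator.\<close>

lemma has_trace_off_diagonal:
  assumes X: "has_adjoint X X'" and \<epsilon>: "\<epsilon> \<in> E" "\<delta> \<in> E" "\<epsilon> \<noteq> \<delta>"
  shows "has_trace (\<lambda>x. P \<epsilon> (X (P \<delta> (\<rho> x)))) 0"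
proof -
  let ?A = "\<lambda>x. P \<epsilon> (X (P \<delta> (\<rho> x)))"
  define V where "V x = x + (- 2) *\<^sub>C P \<epsilon> x" for x
  have linP: "clinear (P \<epsilon>)" using \<epsilon> by (intro clinear_P)
  have lin\<rho>: "clinear \<rho>" using density_op_psd[OF rho] by (simp add: psd_op_def)
  have "has_adjoint (\<lambda>x. x) (\<lambda>x. x :: 'h)"
    by (simp add: has_adjoint_def bounded_clinear_def bounded_linear_ident)
  from has_adjoint_add[OF this has_adjoint_scaleC[OF P_adjoint[OF \<epsilon>(1)], of "-2"]]
  have "has_adjoint V V"
    by (simp add: V_def[abs_def])
  then have V: "hermitian_op V" by (simp add: hermitian_op_def has_adjoint_def)
  have VV: "V (V x) = x" for x
  proof -
    \<comment> \<open>As \<open>P \<epsilon>\<close> is idempotent, its coefficient is -2 - 2 + 4 =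
      0.\<close>
    have "V (V x) = x + (- 2 + (- 2 + (- 2) * (- 2))) *\<^sub>C P \<epsilon> x"
      unfolding V_def clinear_add[OF linP] clinear_scaleC[OF linP] P_P[OF \<epsilon>(1,1)] scaleC_add_left
      by (simp only: scaleC_add_right scaleC_scaleC add.assoc if_True refl)
    then show ?thesis by simp
  qed
  have "has_trace ((\<lambda>x. P \<epsilon> (X (P \<delta> x))) \<circ> \<rho>) (ctrace ((\<lambda>x. P \<epsilon> (X (P \<delta> x))) \<circ> \<rho>))"
    by (rule has_trace_density[OF rho has_adjoint_compose[OF
          has_adjoint_compose[OF P_adjoint[OF \<epsilon>(1)] X] P_adjoint[OF \<epsilon>(2)]]])
  then obtain c where c: "has_trace ?A c" by (auto simp: comp_def)
  have "has_trace (\<lambda>x. V (?A (V x))) c"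
    by (rule has_trace_conj_involution[OF V VV c])
  moreover have "V (?A (V x)) = (- 1) *\<^sub>C ?A x" for x
  proof -
    \<comment> \<open>\<rho> leaves the range of \<open>P \<epsilon>\<close> invariant and
      \<open>P \<delta>\<close> annihilates that range, so the reflection on the right has no
      effect.\<close>
    have "P \<delta> (\<rho> (P \<epsilon> x)) = 0"
      using \<epsilon> P_rho_commute[OF \<epsilon>(1), of x, symmetric] by (simp add: P_P)
    then have "P \<delta> (\<rho> (V x)) = P \<delta> (\<rho> x)"
      unfolding V_def clinear_add[OF lin\<rho>] clinear_scaleC[OF lin\<rho>]
        clinear_add[OF clinear_P[OF \<epsilon>(2)]] clinear_scaleC[OF clinear_P[OF \<epsilon>(2)]]
      by simp
    \<comment> \<open>On the left the reflection is -1 on the range of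
      \<open>P \<epsilon>\<close>.\<close>
    then have "V (?A (V x)) = 1 *\<^sub>C ?A x + (- 2) *\<^sub>C ?A x"
      unfolding V_def[of "?A (V x)"] by (simp add: P_P \<epsilon>)
    then show ?thesis
      by (simp only: scaleC_add_left[symmetric]) simp
  qed
  moreover have "has_trace (\<lambda>x. (- 1) *\<^sub>C ?A x) ((- 1) * c)"
    using has_trace_linear_combination[of "{()}" "\<lambda>_. ?A" "\<lambda>_. c" "\<lambda>_. - 1"] c by simp
  ultimately have "c = (- 1) * c" by (simp only: has_trace_unique)
  then have "c = 0" by simp
  then show ?thesis using c by simp
qed

text \<open>A term \<open>P a A P b P c B P d \<rho>\<close> can have nonzero trace only if
  \<open>b = c\<close>, by orthogonality, and \<open>a = d\<close>, by the reflection argument. Then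
  \<open>\<omega> = b - a = c - d = \<omega>'\<close>.\<close>

lemma ctrace_freq_components_off_diagonal:
  assumes A: "hermitian_op A" and B: "hermitian_op B" and ne: "\<omega> \<noteq> \<omega>'"
  shows "ctrace (freq_component E P A \<omega> \<circ> freq_component E P B (- \<omega>') \<circ> \<rho>) = 0"
proof -
  let ?I = "\<lambda>\<omega>. {(\<epsilon>, \<epsilon>'). \<epsilon> \<in> E \<and> \<epsilon>' \<in> E \<and> \<epsilon>' - \<epsilon> = \<omega>}"
  let ?T = "\<lambda>p q x. P (fst p) (A (P (snd p) (P (fst q) (B (P (snd q) (\<rho> x))))))"
  have A': "has_adjoint A A" "clinear A" and B': "has_adjoint B B"
    using A B by (auto intro: hermitian_op_has_adjoint has_adjoint_clinear)
  \<comment> \<open>The unit weights bring the double sum into the shape of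
    \<open>has_trace_linear_combination\<close>.\<close>
  have expand: "(freq_component E P A \<omega> \<circ> freq_component E P B (- \<omega>') \<circ> \<rho>) =
      (\<lambda>x. \<Sum>p\<in>?I \<omega>. 1 *\<^sub>C (\<Sum>q\<in>?I (- \<omega>'). 1 *\<^sub>C ?T p q x))"
  proof
    fix x
    show "(freq_component E P A \<omega> \<circ> freq_component E P B (- \<omega>') \<circ> \<rho>) x =
        (\<Sum>p\<in>?I \<omega>. 1 *\<^sub>C (\<Sum>q\<in>?I (- \<omega>'). 1 *\<^sub>C ?T p q x))"
      unfolding freq_component_def o_apply split_beta scaleC_one
      by (intro sum.cong refl)
        (auto simp: clinear_sum[OF A'(2)] clinear_sum[OF clinear_P] split_beta)
  qed
  have "has_trace (?T p q) 0" if "p \<in> ?I \<omega>" "q \<in> ?I (- \<omega>')" for p q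
  proof (cases "fst p = snd q")
    case True
    then have "snd p \<noteq> fst q" using that ne by auto
    then have "?T p q = (\<lambda>x. 0)"
      using that by (auto simp: P_P fun_eq_iff clinear_zero[OF A'(2)] clinear_zero[OF clinear_P])
    then show ?thesis by (simp add: has_trace_zero)
  next
    case False
    have "has_adjoint (\<lambda>x. A (P (snd p) (P (fst q) (B x)))) (\<lambda>x. B (P (fst q) (P (snd p) (A x))))"
      using that has_adjoint_compose[OF has_adjoint_compose[OF has_adjoint_compose[OF A'(1) P_adjoint] P_adjoint] B']
      by auto
    then show ?thesis
      using that False by (intro has_trace_off_diagonal) auto
  qed
  then have "has_trace (freq_component E P A \<omega> \<circ> freq_component E P B (- \<omega>') \<circ> \<rho>)
      (\<Sum>p\<in>?I \<omega>. 1 * (\<Sum>q\<in>?I (- \<omega>'). 1 * 0))"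
    unfolding expand by (intro has_trace_linear_combination) auto
  then show ?thesis by (simp add: ctrace_eqI)
qed

text \<open>The double sum over frequencies collapses to its diagonal, where the phases at
  \<open>t\<close> and \<open>t - s\<close> combine to one that depends on \<open>s\<close>
  alone.\<close>

lemma environment_correlation:
  assumes B: "\<And>\<beta>. hermitian_op (B \<beta> :: 'h \<Rightarrow> 'h)"
  shows "ctrace (heisenberg H (B \<beta>) t \<circ> heisenberg H (B \<beta>') (t - s) \<circ> \<rho>) =
    (\<Sum>\<omega>\<in>transition_freqs E. exp (- \<i> * of_real (\<omega> * s)) * corr_mat E P B \<rho> \<omega> $ \<beta> $ \<beta>')"
proof -
  let ?\<Omega> = "transition_freqs E"
  let ?F = "\<lambda>\<omega>. freq_component E P (B \<beta>) \<omega>" and ?G = "\<lambda>\<omega>. freq_component E P (B \<beta>') (- \<omega>)"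
  let ?a = "\<lambda>\<omega>. exp (- \<i> * of_real (\<omega> * t))" and ?b = "\<lambda>\<omega>. exp (\<i> * of_real (\<omega> * (t - s)))"
  have lin: "clinear (B \<beta>)" for \<beta>
    using B by (auto intro: hermitian_op_has_adjoint has_adjoint_clinear)
  have linF: "clinear (?F \<omega>)" for \<omega>
    using freq_component_adjoint[OF B] has_adjoint_clinear by blast
  have tr: "has_trace (?F \<omega> \<circ> ?G \<omega>' \<circ> \<rho>) (ctrace (?F \<omega> \<circ> ?G \<omega>' \<circ> \<rho>))" for \<omega> \<omega>'
    using has_trace_density[OF rho has_adjoint_compose[OF freq_component_adjoint[OF B]
          freq_component_adjoint[OF B]]]
    by (simp add: comp_def)
  \<comment> \<open>The second factor is expanded over negated frequencies, so that the diagonal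
    products are those entering \<open>corr_mat\<close>.\<close>
  have "heisenberg H (B \<beta>) t \<circ> heisenberg H (B \<beta>') (t - s) \<circ> \<rho> =
      (\<lambda>x. \<Sum>\<omega>\<in>?\<Omega>. ?a \<omega> *\<^sub>C (\<Sum>\<omega>'\<in>?\<Omega>. ?b \<omega>' *\<^sub>C (?F \<omega> \<circ> ?G \<omega>' \<circ> \<rho>) x))"
    unfolding fun_eq_iff o_apply heisenberg_freq_components[OF lin, of \<beta>]
      heisenberg_freq_components'[OF lin, of \<beta>'] clinear_sum[OF linF] clinear_scaleC[OF linF]
    by simp
  then have "has_trace (heisenberg H (B \<beta>) t \<circ> heisenberg H (B \<beta>') (t - s) \<circ> \<rho>)
      (\<Sum>\<omega>\<in>?\<Omega>. ?a \<omega> * (\<Sum>\<omega>'\<in>?\<Omega>. ?b \<omega>' * ctrace (?F \<omega> \<circ> ?G \<omega>' \<circ> \<rho>)))"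
    by (simp only:) (intro has_trace_linear_combination tr)
  then have "ctrace (heisenberg H (B \<beta>) t \<circ> heisenberg H (B \<beta>') (t - s) \<circ> \<rho>) =
      (\<Sum>\<omega>\<in>?\<Omega>. ?a \<omega> * (\<Sum>\<omega>'\<in>?\<Omega>. ?b \<omega>' * ctrace (?F \<omega> \<circ> ?G \<omega>' \<circ> \<rho>)))"
    by (rule ctrace_eqI)
  also have "\<dots> = (\<Sum>\<omega>\<in>?\<Omega>. exp (- \<i> * of_real (\<omega> * s)) * corr_mat E P B \<rho> \<omega> $ \<beta> $ \<beta>')"
  proof (intro sum.cong refl)
    fix \<omega> assume \<omega>: "\<omega> \<in> ?\<Omega>"
    have "(\<Sum>\<omega>'\<in>?\<Omega>. ?b \<omega>' * ctrace (?F \<omega> \<circ> ?G \<omega>' \<circ> \<rho>)) =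
        (\<Sum>\<omega>'\<in>?\<Omega>. if \<omega>' = \<omega> then ?b \<omega> * ctrace (?F \<omega> \<circ> ?G \<omega> \<circ> \<rho>) else 0)"
      by (intro sum.cong refl) (auto simp: ctrace_freq_components_off_diagonal[OF B B] simp del: o_apply)
    also have "\<dots> = ?b \<omega> * ctrace (?F \<omega> \<circ> ?G \<omega> \<circ> \<rho>)"
      using \<omega> by (simp add: finite_transition_freqs[OF finite_E])
    finally have "?a \<omega> * (\<Sum>\<omega>'\<in>?\<Omega>. ?b \<omega>' * ctrace (?F \<omega> \<circ> ?G \<omega>' \<circ> \<rho>)) =
        (?a \<omega> * ?b \<omega>) * corr_mat E P B \<rho> \<omega> $ \<beta> $ \<beta>'"
      by (simp only: corr_mat_entry[OF B] mult.assoc)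
    also have "?a \<omega> * ?b \<omega> = exp (- \<i> * of_real (\<omega> * s))"
      unfolding mult_exp_exp by (simp add: algebra_simps)
    finally show "?a \<omega> * (\<Sum>\<omega>'\<in>?\<Omega>. ?b \<omega>' * ctrace (?F \<omega> \<circ> ?G \<omega>' \<circ> \<rho>)) =
        exp (- \<i> * of_real (\<omega> * s)) * corr_mat E P B \<rho> \<omega> $ \<beta> $ \<beta>'" .
  qed
  finally show ?thesis .
qed

end

end

text \<open>The dropped columns have weight zero, so the restricted sum is a full entry of the
  matrix product. The square root times its conjugate restores the eigenvalue because that is
  nonnegative.\<close>

lemma sum_coupling:
  assumes \<gamma>: "psd_mat \<gamma>" "\<gamma> = U \<omega> ** \<Lambda> \<omega> ** mat_dagger (U \<omega>)"
    and U: "unitary_mat (U \<omega>)" and D: "diagonal_mat (\<Lambda> \<omega>)"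
  shows "(\<Sum>l | \<Lambda> \<omega> $ l $ l \<noteq> 0. coupling U \<Lambda> \<beta> l \<omega> * cnj (coupling U \<Lambda> \<beta>' l \<omega>)) = \<gamma> $ \<beta> $ \<beta>'"
proof -
  have "coupling U \<Lambda> \<beta> l \<omega> * cnj (coupling U \<Lambda> \<beta>' l \<omega>) =
      U \<omega> $ \<beta> $ l * \<Lambda> \<omega> $ l $ l * cnj (U \<omega> $ \<beta>' $ l)" for l
  proof -
    have "coupling U \<Lambda> \<beta> l \<omega> * cnj (coupling U \<Lambda> \<beta>' l \<omega>) =
        U \<omega> $ \<beta> $ l * (csqrt (\<Lambda> \<omega> $ l $ l) * cnj (csqrt (\<Lambda> \<omega> $ l $ l))) * cnj (U \<omega> $ \<beta>' $ l)"
      by (simp add: coupling_def mult_ac)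
    then show ?thesis
      unfolding csqrt_mult_cnj[OF psd_diagonalisation_nonneg[OF \<gamma> U D]] .
  qed
  then have "(\<Sum>l | \<Lambda> \<omega> $ l $ l \<noteq> 0. coupling U \<Lambda> \<beta> l \<omega> * cnj (coupling U \<Lambda> \<beta>' l \<omega>)) =
      (\<Sum>l\<in>UNIV. U \<omega> $ \<beta> $ l * \<Lambda> \<omega> $ l $ l * cnj (U \<omega> $ \<beta>' $ l))"
    by (intro sum.mono_neutral_cong_left) auto
  then show ?thesis
    by (simp add: \<gamma>(2) mult_diagonal_entry[OF D])
qed

theorem mainTheorem3:
  fixes H \<rho> :: "'h::chilbert_space \<Rightarrow> 'h"
    and E :: "real set" and P :: "real \<Rightarrow> 'h \<Rightarrow> 'h"
    and B :: "'b::finite \<Rightarrow> 'h \<Rightarrow> 'h"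
    and U \<Lambda> :: "real \<Rightarrow> complex ^ 'b ^ 'b"
    and ket :: "'b mode_label \<Rightarrow> 'k::chilbert_space"
  assumes H: "spectral_decomposition H E P"
    and rho: "density_op \<rho>"
    and stationary: "H \<circ> \<rho> = \<rho> \<circ> H"
    and B: "\<And>\<beta>. hermitian_op (B \<beta>)"
    and diagonalisation: "\<And>\<omega>. \<omega> \<in> transition_freqs E \<Longrightarrow>
          unitary_mat (U \<omega>) \<and> diagonal_mat (\<Lambda> \<omega>) \<and>
          corr_mat E P B \<rho> \<omega> = U \<omega> ** \<Lambda> \<omega> ** mat_dagger (U \<omega>)"
    and basis: "is_onb_on (mode_labels (modes (transition_freqs E) \<Lambda>)) ket"
  shows "(\<forall>\<omega>\<in>transition_freqs E. psd_mat (corr_mat E P B \<rho> \<omega>)) \<and>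
    cdim (UNIV :: 'k set) = 1 + (\<Sum>\<omega>\<in>transition_freqs E. rank (corr_mat E P B \<rho> \<omega>)) \<and>
    1 + (\<Sum>\<omega>\<in>transition_freqs E. rank (corr_mat E P B \<rho> \<omega>))
      \<le> 1 + card (transition_freqs E) * CARD('b) \<and>
    (let J = modes (transition_freqs E) \<Lambda>;
         H' = aux_hamiltonian ket J;
         B' = aux_coupling_op ket J (coupling U \<Lambda>);
         \<rho>' = aux_state ket
     in \<forall>\<beta> \<beta>'. \<forall>t s :: real.
          ctrace (heisenberg H' (B' \<beta>) t \<circ> heisenberg H' (B' \<beta>') (t - s) \<circ> \<rho>') =
          ctrace (heisenberg H (B \<beta>) t \<circ> heisenberg H (B \<beta>') (t - s) \<circ> \<rho>))"
proof -
  let ?\<Omega> = "transition_freqs E"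
  let ?L = "\<lambda>\<omega>. {l. \<Lambda> \<omega> $ l $ l \<noteq> 0}"
  define J where "J = modes ?\<Omega> \<Lambda>"
  \<comment> \<open>As a dependent product, \<open>J\<close> has the sum of the ranks as
    cardinality, and sums over \<open>J\<close> become iterated sums over frequency and
    mode.\<close>
  have J_Sigma: "J = Sigma ?\<Omega> ?L"
    by (auto simp: J_def modes_def)
  have fin: "finite ?\<Omega>"
    by (rule finite_transition_freqs[OF finite_E[OF H]])
  then have J: "finite J"
    by (simp add: J_Sigma)
  have psd: "psd_mat (corr_mat E P B \<rho> \<omega>)" for \<omega>
    by (rule psd_corr_mat[OF H rho B])
  have rank: "rank (corr_mat E P B \<rho> \<omega>) = card (?L \<omega>)" if "\<omega> \<in> ?\<Omega>" for \<omega>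
    using diagonalisation[OF that] rank_unitary_diagonalisation by blast
  have "(\<Sum>\<omega>\<in>?\<Omega>. rank (corr_mat E P B \<rho> \<omega>)) = card J"
    using fin by (simp add: rank J_Sigma)
  then have dim: "cdim (UNIV :: 'k set) = 1 + (\<Sum>\<omega>\<in>?\<Omega>. rank (corr_mat E P B \<rho> \<omega>))"
    using cdim_finite_onb[OF basis finite_mode_labels] card_mode_labels J by (simp add: J_def)
  have "rank (corr_mat E P B \<rho> \<omega>) \<le> CARD('b)" if "\<omega> \<in> ?\<Omega>" for \<omega>
    unfolding rank[OF that] by (rule card_mono) auto
  then have bound: "(\<Sum>\<omega>\<in>?\<Omega>. rank (corr_mat E P B \<rho> \<omega>)) \<le> card ?\<Omega> * CARD('b)"
    using sum_bounded_above[of ?\<Omega> "\<lambda>\<omega>. rank (corr_mat E P B \<rho> \<omega>)" "CARD('b)"] by simp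
  have "ctrace (heisenberg (aux_hamiltonian ket J) (aux_coupling_op ket J (coupling U \<Lambda>) \<beta>) t \<circ>
        heisenberg (aux_hamiltonian ket J) (aux_coupling_op ket J (coupling U \<Lambda>) \<beta>') (t - s) \<circ>
        aux_state ket) =
      ctrace (heisenberg H (B \<beta>) t \<circ> heisenberg H (B \<beta>') (t - s) \<circ> \<rho>)" for \<beta> \<beta>' t s
  proof -
    let ?g = "coupling U \<Lambda>"
    have "(\<Sum>(\<omega>, l)\<in>J. exp (- \<i> * of_real (\<omega> * s)) * (?g \<beta> l \<omega> * cnj (?g \<beta>' l \<omega>))) =
        (\<Sum>\<omega>\<in>?\<Omega>. \<Sum>l\<in>?L \<omega>. exp (- \<i> * of_real (\<omega> * s)) * (?g \<beta> l \<omega> * cnj (?g \<beta>' l \<omega>)))"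
      unfolding J_Sigma using fin by (intro sum.Sigma[symmetric]) auto
    also have "\<dots> = (\<Sum>\<omega>\<in>?\<Omega>. exp (- \<i> * of_real (\<omega> * s)) * corr_mat E P B \<rho> \<omega> $ \<beta> $ \<beta>')"
    proof (intro sum.cong refl)
      fix \<omega> assume "\<omega> \<in> ?\<Omega>"
      then have "(\<Sum>l\<in>?L \<omega>. ?g \<beta> l \<omega> * cnj (?g \<beta>' l \<omega>)) = corr_mat E P B \<rho> \<omega> $ \<beta> $ \<beta>'"
        using diagonalisation by (intro sum_coupling[OF psd]) auto
      then show "(\<Sum>l\<in>?L \<omega>. exp (- \<i> * of_real (\<omega> * s)) * (?g \<beta> l \<omega> * cnj (?g \<beta>' l \<omega>))) =
          exp (- \<i> * of_real (\<omega> * s)) * corr_mat E P B \<rho> \<omega> $ \<beta> $ \<beta>'"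
        by (simp only: sum_distrib_left[symmetric])
    qed
    finally show ?thesis
      unfolding aux_correlation[OF basis[folded J_def] J]
        environment_correlation[where B = B, OF H rho stationary B] .
  qed
  then show ?thesis
    using psd dim bound by (simp add: Let_def J_def)
qed

end
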